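(* Let $\mu,\nu\in\mathbb{C}$. The following pair of (mutually inverse) series expansions holds. (i) For $x\in(2^{-1/2},1)$; also for $x=2^{-1/2}$ if $\operatorname{Re}(3\nu-\mu)<-1$; and for all $x\in(0,1)$ if $-\nu\in\mathbb{N}$ or $-\frac{\mu+\nu+1}{2}\in\mathbb{N}_0$: $$P_\nu^{-\mu}(x)=\sum_{n=0}^\infty\frac{\left(\frac{\mu+\nu+1}{2}\right)_n(\nu+1)_n}{(-2)^{-n}\,n!\,(1-x^2)^{-\frac n2}\,x^{\nu+n+1}}\,P_{\nu+n}^{-\mu-n}\!\left(\frac1x\right).$$ (ii) For $x\in(0,1)$: $$\frac{P_\nu^{-\mu}\left(\frac1x\right)}{x^{\nu+1}}=\sum_{n=0}^\infty\frac{\left(\frac{\mu+\nu+1}{2}\right)_n(\nu+1)_n}{2^{-n}\,n!\,(1-x^2)^{-\frac n2}}\,P_{\nu+n}^{-\mu-n}(x).$$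
   Context: $\mathbb{N}=\{1,2,\dots\}$, $\mathbb{N}_0=\mathbb{N}\cup\{0\}$; $(a)_n=a(a+1)\cdots(a+n-1)$, $(a)_0=1$. For $\mu,\nu\in\mathbb{C}$ and real $x>-1$, $x\ne1$, $$P_\nu^{-\mu}(x)=\left|\frac{1-x}{1+x}\right|^{\mu/2}\frac{F\left(-\nu,\nu+1;1+\mu;\frac{1-x}{2}\right)}{\Gamma(1+\mu)},$$ where $F(a,b;c;t)$ is the Gauss hypergeometric function (analytically continued to $t\le-1$), and $F(a,b;c;t)/\Gamma(c)$ is understood as the regularized function, entire in $a,b,c$. For $|x|<1$ this is the Ferrers function of the first kind, for $x>1$ the associated Legendre function of the first kind. *)

theory Defs
  imports "HOL-Complex_Analysis.Complex_Analysis"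
begin

text \<open>
  The regularized Gauss series \<open>F(a,b;c;z) / \<Gamma>(c)\<close>, using
  \<open>1 / (\<Gamma>(c) (c)\<^sub>n) = 1 / \<Gamma>(c + n)\<close>; since \<open>rGamma\<close> is entire, no restriction on
  \<open>c\<close> is needed.
\<close>
definition hypergeo_reg_series :: "complex \<Rightarrow> complex \<Rightarrow> complex \<Rightarrow> complex \<Rightarrow> complex" where
  "hypergeo_reg_series a b c z =
     (\<Sum>n. pochhammer a n * pochhammer b n * rGamma (c + of_nat n) / fact n * z ^ n)"

text \<open>
  Its analytic continuation from the unit disc, taken along the straight line from \<open>0\<close> to
  \<open>z\<close>: the value at \<open>z\<close> of any holomorphic extension to an open set that is star-shaped about
  \<open>0\<close>. This is the principal branch on the plane cut along \<open>[1,\<infinity>)\<close>.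
\<close>
definition hypergeo_reg :: "complex \<Rightarrow> complex \<Rightarrow> complex \<Rightarrow> complex \<Rightarrow> complex" where
  "hypergeo_reg a b c z =
     (THE w. \<exists>S f. open S \<and> (\<forall>u\<in>S. closed_segment 0 u \<subseteq> S) \<and> ball 0 1 \<subseteq> S \<and> z \<in> S \<and>
        f holomorphic_on S \<and> (\<forall>u\<in>ball 0 1. f u = hypergeo_reg_series a b c u) \<and> w = f z)"

lemma hypergeo_reg_eqI:
  assumes S: "open S" "\<And>u. u \<in> S \<Longrightarrow> closed_segment 0 u \<subseteq> S" "ball 0 1 \<subseteq> S" "z \<in> S"
    and f: "f holomorphic_on S" "\<And>u. u \<in> ball 0 1 \<Longrightarrow> f u = hypergeo_reg_series a b c u"
  shows "hypergeo_reg a b c z = f z"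
  unfolding hypergeo_reg_def
proof (rule the_equality)
  show "\<exists>S g. open S \<and> (\<forall>u\<in>S. closed_segment 0 u \<subseteq> S) \<and> ball 0 1 \<subseteq> S \<and> z \<in> S \<and>
      g holomorphic_on S \<and> (\<forall>u\<in>ball 0 1. g u = hypergeo_reg_series a b c u) \<and> f z = g z"
    using assms by (intro exI[of _ S] exI[of _ f]) simp
next
  fix w
  assume "\<exists>T g. open T \<and> (\<forall>u\<in>T. closed_segment 0 u \<subseteq> T) \<and> ball 0 1 \<subseteq> T \<and> z \<in> T \<and>
      g holomorphic_on T \<and> (\<forall>u\<in>ball 0 1. g u = hypergeo_reg_series a b c u) \<and> w = g z"
  then obtain T g where "open T \<and> (\<forall>u\<in>T. closed_segment 0 u \<subseteq> T) \<and> ball 0 1 \<subseteq> T \<and> z \<in> T \<and>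
      g holomorphic_on T \<and> (\<forall>u\<in>ball 0 1. g u = hypergeo_reg_series a b c u) \<and> w = g z"
    by (elim exE)
  hence T: "open T" "\<And>u. u \<in> T \<Longrightarrow> closed_segment 0 u \<subseteq> T" "ball 0 1 \<subseteq> T" "z \<in> T"
    and g: "g holomorphic_on T" "\<And>u. u \<in> ball 0 1 \<Longrightarrow> g u = hypergeo_reg_series a b c u"
    and w: "w = g z" by simp_all
  have "starlike (S \<inter> T)"
    unfolding starlike_def
  proof (intro bexI ballI)
    show "0 \<in> S \<inter> T" using S(3) T(3) by auto
    fix u assume "u \<in> S \<inter> T"
    hence u: "u \<in> S" "u \<in> T" by simp_all
    show "closed_segment 0 u \<subseteq> S \<inter> T" by (rule Int_greatest[OF S(2)[OF u(1)] T(2)[OF u(2)]])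
  qed
  hence conn: "connected (S \<inter> T)" by (rule starlike_imp_connected)
  have "g z = f z"
  proof (rule analytic_continuation_open[where s = "ball 0 1" and f = g and g = f])
    show "open (ball (0::complex) 1)" "ball (0::complex) 1 \<noteq> {}" by simp_all
    show "open (S \<inter> T)" using S(1) T(1) by (rule open_Int)
    show "connected (S \<inter> T)" by (rule conn)
    show "ball 0 1 \<subseteq> S \<inter> T" using S(3) T(3) by (rule Int_greatest)
    show "g holomorphic_on S \<inter> T" using g(1) by (rule holomorphic_on_subset) simp
    show "f holomorphic_on S \<inter> T" using f(1) by (rule holomorphic_on_subset) simp
    show "g u = f u" if "u \<in> ball 0 1" for u
      by (rule trans[OF g(2)[OF that] f(2)[OF that, symmetric]])
    show "z \<in> S \<inter> T" using S(4) T(4) by (rule IntI)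
  qed
  with w show "w = f z" by simp
qed

text \<open>
  \<open>legendre_P \<nu> m x\<close> is \<open>P\<^sub>\<nu>\<^sup>m(x)\<close> (degree \<open>\<nu>\<close>, order \<open>m\<close>), intended for real \<open>x > -1\<close>, \<open>x \<noteq> 1\<close>:
  the Ferrers function of the first kind for \<open>x < 1\<close>, the associated Legendre function of the
  first kind for \<open>x > 1\<close>.
\<close>
definition legendre_P :: "complex \<Rightarrow> complex \<Rightarrow> real \<Rightarrow> complex" where
  "legendre_P \<nu> m x =
     of_real \<bar>(1 - x) / (1 + x)\<bar> powr (- m / 2) *
     hypergeo_reg (- \<nu>) (\<nu> + 1) (1 - m) (of_real ((1 - x) / 2))"

end

theory Submission
  imports Defs
begin

text \<open>
Write \<open>a = (\<mu> + \<nu> + 1) / 2\<close>, \<open>b = (\<mu> - \<nu>) / 2\<close>, \<open>c = 1 + \<mu>\<close>, \<open>d = \<nu> + 1\<close>, and let \<open>H\<close> be the regularized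
hypergeometric function. Both expansions are instances of a single identity,
\<open>H(a, b + d; c; w) = (\<Sum>n. (a)\<^sub>n (d)\<^sub>n / n! * w ^ n * H(b, a + n; c + n; w))\<close>,
which adds \<open>d\<close> to the parameter \<open>b\<close>. It is proved by comparing powers of \<open>w\<close>: the
coefficient of \<open>w ^ N\<close> on the right is a Chu--Vandermonde sum.

The link is a quadratic transformation: for every \<open>x > 0\<close> other than \<open>1\<close>, the Legendre function of degree \<open>\<nu>\<close> and order
\<open>- \<mu>\<close> equals \<open>2\<^sup>-\<^sup>\<mu> \<bar>1 - x\<^sup>2\<bar>\<^sup>\<mu>\<^sup>/\<^sup>2 H(a, b; c; 1 - x\<^sup>2)\<close> (lemma \<open>legendre_P_quadratic\<close>). Replacing
\<open>\<mu>, \<nu>\<close> by \<open>\<mu> + n, \<nu> + n\<close> changes \<open>a, b, c\<close> to \<open>a + n, b, c + n\<close>, exactly as in the identity. So the series of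
Legendre functions at \<open>x\<close> is the identity at \<open>w = 1 - x\<^sup>2\<close>, and the series at \<open>1 / x\<close> is the identity at
\<open>w = 1 - 1 / x\<^sup>2\<close>. Pfaff's transformation exchanges these two arguments and turns each sum into the
Legendre function at the reciprocal point.

The different ranges of \<open>x\<close> reflect the range of \<open>w\<close>. For \<open>0 < x < 1\<close> the argument \<open>1 - x\<^sup>2\<close>
is always in the unit disc (lemma \<open>addition_series_disc\<close>), whereas \<open>1 - 1 / x\<^sup>2\<close> is in the disc only
if \<open>x\<^sup>2 > 1 / 2\<close>. The endpoint \<open>x\<^sup>2 = 1 / 2\<close> is \<open>w = - 1\<close>, where the terms decay like
\<open>n\<close> to the power \<open>a + d - c - 1\<close>, and \<open>Re (a + d - c) < 0\<close> is the condition \<open>Re (3 * \<nu> - \<mu>) < - 1\<close> (lemma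
\<open>addition_series_minus_1\<close>). If \<open>a\<close> or \<open>d\<close> is a nonpositive integer, the sum is finite and the
identity continues analytically to all \<open>w < 0\<close> (lemma \<open>addition_series_terminating\<close>).

Pfaff's transformation and the quadratic one are proved first near \<open>0\<close>, again by diagonal sums and Vandermonde.
Pfaff's also provides the continuation of the series to the half-plane \<open>Re z < 1 / 2\<close>, which
contains all the negative arguments needed, and the uniform bounds used at \<open>w = - 1\<close>.
\<close>

section \<open>The regularized hypergeometric series\<close>

lemma tendsto_shifted_ratio:
  fixes p q :: complex
  shows "(\<lambda>n. (p + of_nat n) / (q + of_nat n)) \<longlonglongrightarrow> 1"
proof -
  have "(\<lambda>n. (p * inverse (of_nat n) + 1) / (q * inverse (of_nat n) + 1)) \<longlonglongrightarrow> (p * 0 + 1) / (q * 0 + 1)"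
    by (intro tendsto_intros lim_inverse_n) auto
  moreover have "\<forall>\<^sub>F n in sequentially. (p * inverse (of_nat n) + 1) / (q * inverse (of_nat n) + 1)
      = (p + of_nat n) / (q + of_nat n)"
    using eventually_gt_at_top[of 0]
  proof eventually_elim
    case (elim n)
    hence "(p + of_nat n) / (q + of_nat n) = ((p + of_nat n) * inverse (of_nat n)) / ((q + of_nat n) * inverse (of_nat n))"
      by simp
    also have "\<dots> = (p * inverse (of_nat n) + 1) / (q * inverse (of_nat n) + 1)"
      using elim by (simp add: ring_distribs)
    finally show ?case by simp
  qed
  ultimately show ?thesis by (simp add: Lim_transform_eventually)
qed

text \<open>
The coefficients of the regularized series.
Keeping \<open>rGamma (c + of_nat n)\<close> in the numerator, rather than a Pochhammer
symbol of \<open>c\<close> in the denominator, is what lets every identity below hold for all \<open>c\<close>.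
\<close>
definition hyp_coeff :: "complex \<Rightarrow> complex \<Rightarrow> complex \<Rightarrow> nat \<Rightarrow> complex" where
  "hyp_coeff a b c n = pochhammer a n * pochhammer b n * rGamma (c + of_nat n) / fact n"

lemma hypergeo_reg_series_commute: "hypergeo_reg_series a b c z = hypergeo_reg_series b a c z"
  by (simp add: hypergeo_reg_series_def mult_ac)

lemma hypergeo_reg_commute: "hypergeo_reg a b c z = hypergeo_reg b a c z"
  unfolding hypergeo_reg_def hypergeo_reg_series_commute[of a b c] ..

lemma rGamma_of_nat_shift: "rGamma (c + of_nat n) = (c + of_nat n) * rGamma (c + of_nat (Suc n))" for c :: complex
  using rGamma_plus1[of "c + of_nat n"] by (simp add: add_ac)

lemma hyp_coeff_Suc:
  "(c + of_nat n) * (1 + of_nat n) * hyp_coeff a b c (Suc n) =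
     (a + of_nat n) * (b + of_nat n) * hyp_coeff a b c n"
proof -
  have "1 + of_nat n \<noteq> (0 :: complex)" by (metis nat.distinct(1) of_nat_Suc of_nat_eq_0_iff)
  define X where "X = pochhammer a n * pochhammer b n * rGamma (c + of_nat (Suc n)) / fact n"
  have "(1 + of_nat n) * hyp_coeff a b c (Suc n) = (a + of_nat n) * (b + of_nat n) * X"
    using \<open>1 + of_nat n \<noteq> 0\<close> unfolding X_def
    by (simp add: hyp_coeff_def pochhammer_Suc divide_simps del: of_nat_Suc) (simp add: mult_ac)
  moreover have "hyp_coeff a b c n = (c + of_nat n) * X"
    by (simp add: X_def hyp_coeff_def rGamma_of_nat_shift[of c n] del: of_nat_Suc)
  ultimately show ?thesis by algebra
qed

lemma hyp_coeff_Suc_ratio: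
  assumes "c + of_nat n \<noteq> 0"
  shows "hyp_coeff a b c (Suc n) =
           (a + of_nat n) * (b + of_nat n) * hyp_coeff a b c n / ((c + of_nat n) * (1 + of_nat n))"
proof -
  have "1 + of_nat n \<noteq> (0 :: complex)" by (metis nat.distinct(1) of_nat_Suc of_nat_eq_0_iff)
  thus ?thesis using hyp_coeff_Suc[of c n a b] assms
    by (intro eq_divide_imp) (simp_all only: mult_eq_0_iff mult_ac simp_thms)
qed

lemma eventually_add_of_nat_nonzero:
  fixes c :: complex
  shows "\<forall>\<^sub>F n in sequentially. c + of_nat n \<noteq> 0"
proof -
  have "\<forall>\<^sub>F n in sequentially. real n > norm c"
    by (rule eventually_gt_at_top[THEN eventually_compose_filterlim, OF filterlim_real_sequentially])
  thus ?thesis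
    by eventually_elim (metis add_eq_0_iff norm_minus_cancel norm_of_nat order_less_irrefl)
qed

text \<open>
Consecutive terms have a ratio tending to \<open>z\<close>. If \<open>c\<close> is a nonpositive integer, some leading coefficients vanish, so
the ratio is taken only after the index where \<open>c + of_nat n\<close> could be zero.
\<close>
lemma hyp_coeff_summable:
  assumes "norm z < 1"
  shows "summable (\<lambda>n. norm (hyp_coeff a b c n * z ^ n))"
proof -
  define q where "q = (norm z + 1) / 2"
  have q: "q < 1" "norm z < q" using assms by (auto simp: q_def)
  define \<rho> where "\<rho> n = (a + of_nat n) / (c + of_nat n) * ((b + of_nat n) / (1 + of_nat n)) * z" for n
  have "\<rho> \<longlonglongrightarrow> 1 * 1 * z" unfolding \<rho>_def by (intro tendsto_intros tendsto_shifted_ratio)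
  hence "(\<lambda>n. norm (\<rho> n)) \<longlonglongrightarrow> norm z" using tendsto_norm by fastforce
  hence "\<forall>\<^sub>F n in sequentially. norm (\<rho> n) < q" using q(2) by (rule order_tendstoD)
  moreover have "\<forall>\<^sub>F n in sequentially. c + of_nat n \<noteq> 0" by (rule eventually_add_of_nat_nonzero)
  ultimately have "\<forall>\<^sub>F n in sequentially. norm (norm (hyp_coeff a b c (Suc n) * z ^ Suc n))
       \<le> q * norm (norm (hyp_coeff a b c n * z ^ n))"
  proof eventually_elim
    case (elim n)
    have "hyp_coeff a b c (Suc n) * z ^ Suc n = \<rho> n * (hyp_coeff a b c n * z ^ n)"
      by (simp add: \<rho>_def hyp_coeff_Suc_ratio[OF elim(2)])
    thus ?case using elim(1) by (simp add: norm_mult mult_right_mono del: power_Suc)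
  qed
  then obtain N where "\<And>n. n \<ge> N \<Longrightarrow> norm (norm (hyp_coeff a b c (Suc n) * z ^ Suc n))
       \<le> q * norm (norm (hyp_coeff a b c n * z ^ n))" by (auto simp: eventually_at_top_linorder)
  thus ?thesis by (rule summable_ratio_test[OF q(1)])
qed

lemma hypergeo_reg_series_sums:
  assumes "norm z < 1"
  shows "(\<lambda>n. hyp_coeff a b c n * z ^ n) sums hypergeo_reg_series a b c z"
  using summable_norm_cancel[OF hyp_coeff_summable[OF assms, of a b c]]
  unfolding hypergeo_reg_series_def hyp_coeff_def by (rule summable_sums)

lemma holomorphic_hypergeo_reg_series: "hypergeo_reg_series a b c holomorphic_on ball 0 1"
  by (rule power_series_holomorphic[where a = "hyp_coeff a b c"])
     (use hypergeo_reg_series_sums[of _ a b c] in auto)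

text \<open>
A crude exponential bound: the terms at \<open>z = 1/2\<close> tend to \<open>0\<close>. With suitable unit parameters it
also bounds plain Pochhammer symbols and values of \<open>rGamma\<close>.
\<close>
lemma hyp_coeff_bound:
  obtains C where "C > 0" "\<And>n. norm (hyp_coeff a b c n) \<le> C * 2 ^ n"
proof -
  have "(\<lambda>n. norm (hyp_coeff a b c n * (1/2) ^ n)) \<longlonglongrightarrow> 0"
    by (rule summable_LIMSEQ_zero[OF hyp_coeff_summable]) simp
  hence "Bseq (\<lambda>n. norm (hyp_coeff a b c n * (1/2) ^ n))" by (intro convergent_imp_Bseq convergentI)
  then obtain C where C: "C > 0" "\<And>n. norm (norm (hyp_coeff a b c n * (1/2) ^ n)) \<le> C"
    by (auto elim: BseqE)
  have "norm (hyp_coeff a b c n) \<le> C * 2 ^ n" for n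
    using C(2)[of n] by (simp add: norm_mult norm_power norm_divide field_simps)
  with C(1) show ?thesis by (rule that)
qed

section \<open>Diagonal summation and Vandermonde convolution\<close>

text \<open>
The rearrangement behind all three double series in this theory: summing by rows gives
the series of functions, and summing by diagonals gives a power series with closed-form coefficients.
\<close>
lemma diagonal_sums:
  fixes g :: "nat \<Rightarrow> nat \<Rightarrow> complex"
  assumes bound: "\<And>N. (\<Sum>k\<le>N. norm (g k (N - k))) \<le> B N" and "summable B"
    and diag: "(\<lambda>N. \<Sum>k\<le>N. g k (N - k)) sums s"
    and rows: "\<And>k. g k sums r k"
  shows "r sums s"
proof -
  have abs: "summable (\<lambda>N. norm (\<Sum>k\<le>N. norm (g k (N - k))))"
  proof (rule summable_comparison_test'[OF \<open>summable B\<close>])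
    show "norm (norm (\<Sum>k\<le>N. norm (g k (N - k)))) \<le> B N" for N
      using bound[of N] sum_nonneg[of "{..N}" "\<lambda>k. norm (g k (N - k))"] by simp
  qed
  let ?D = "Sigma (UNIV :: nat set) (\<lambda>N. {..N})"
  let ?f = "\<lambda>(N, k). g k (N - k)"
  have 1: "((\<lambda>(k, j). g k j) has_sum S) UNIV \<longleftrightarrow> (?f has_sum S) ?D" for S
    by (rule has_sum_reindex_bij_witness[of _ "\<lambda>(N, k). (k, N - k)" "\<lambda>(k, j). (k + j, k)"]) auto
  have 2: "(\<lambda>x. norm (?f x)) summable_on ?D"
  proof (rule summable_on_SigmaI[where g = "\<lambda>N. \<Sum>k\<le>N. norm (g k (N - k))"])
    show "((\<lambda>y. norm (?f (N, y))) has_sum (\<Sum>k\<le>N. norm (g k (N - k)))) {..N}" for N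
      using has_sum_finite[of "{..N}" "\<lambda>k. norm (g k (N - k))"] by simp
    show "(\<lambda>N. \<Sum>k\<le>N. norm (g k (N - k))) summable_on UNIV"
      by (rule norm_summable_imp_summable_on[OF abs])
  qed auto
  hence "?f summable_on ?D" by (rule abs_summable_summable)
  then obtain S where S: "(?f has_sum S) ?D" by (auto simp: summable_on_def)
  have "((\<lambda>N. \<Sum>k\<le>N. g k (N - k)) has_sum S) UNIV"
  proof (rule has_sum_SigmaD[OF S])
    show "((\<lambda>y. ?f (N, y)) has_sum (\<Sum>k\<le>N. g k (N - k))) {..N}" for N
      using has_sum_finite[of "{..N}" "\<lambda>k. g k (N - k)"] by simp
  qed
  hence "S = s" using diag has_sum_imp_sums sums_unique2 by blast
  with S 1 have full: "((\<lambda>(k, j). g k j) has_sum s) (Sigma UNIV (\<lambda>_. UNIV))" by simp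
  have "(r has_sum s) UNIV"
  proof (rule has_sum_SigmaD[OF full])
    fix k
    have "(\<lambda>(k, j). g k j) summable_on (Sigma UNIV (\<lambda>_. UNIV))"
      using full by (auto simp: summable_on_def)
    hence "(\<lambda>j. g k j) summable_on UNIV" by (rule summable_on_SigmaD1) auto
    then obtain t where t: "(g k has_sum t) UNIV" by (auto simp: summable_on_def)
    hence "g k sums t" by (rule has_sum_imp_sums)
    with rows[of k] have "t = r k" by (rule sums_unique2[symmetric])
    with t show "((\<lambda>j. case (k, j) of (k, j) \<Rightarrow> g k j) has_sum r k) UNIV" by simp
  qed
  thus ?thesis by (rule has_sum_imp_sums)
qed

lemma binomial_series_sums:
  fixes z p :: complex
  assumes "norm z < 1"
  shows "(\<lambda>j. pochhammer p j / fact j * z ^ j) sums (1 - z) powr (- p)"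
proof -
  have "(\<lambda>n. ((- p) gchoose n) * (- z) ^ n) sums (1 + (- z)) powr (- p)"
    using assms by (intro gen_binomial_complex) simp
  also have "(\<lambda>n. ((- p) gchoose n) * (- z) ^ n) = (\<lambda>j. pochhammer p j / fact j * z ^ j)"
  proof (rule ext)
    fix j
    have "((- p) gchoose j) * (- z) ^ j = ((- 1) ^ j * (- 1) ^ j) * (pochhammer p j / fact j * z ^ j)"
      by (subst power_minus) (simp only: gbinomial_pochhammer minus_minus mult_ac times_divide_eq_left times_divide_eq_right)
    thus "((- p) gchoose j) * (- z) ^ j = pochhammer p j / fact j * z ^ j"
      by (simp flip: power_mult_distrib)
  qed
  finally show ?thesis by simp
qed

lemma norm_pochhammer_le: "norm (pochhammer z n) \<le> pochhammer (norm z) n" for z :: complex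
proof (induction n)
  case (Suc n)
  have "norm (z + of_nat n) \<le> norm z + real n" by (metis norm_of_nat norm_triangle_ineq)
  with Suc.IH show ?case by (simp add: pochhammer_Suc norm_mult mult_mono')
qed simp

text \<open>
Chu--Vandermonde, divided by \<open>fact N\<close>: the form in which a diagonal sum appears.
\<close>
lemma vandermonde_fact:
  fixes p q :: "'a :: field_char_0"
  shows "(\<Sum>k\<le>N. pochhammer p k * pochhammer q (N - k) / (fact k * fact (N - k))) = pochhammer (p + q) N / fact N"
  unfolding pochhammer_binomial_sum sum_divide_distrib
  by (rule sum.cong) (simp_all add: binomial_fact field_simps)

text \<open>
The next two lemmas bring the \<open>k\<close>-th entry of a diagonal into Vandermonde form: the factor \<open>rGamma (c + of_nat k)\<close> becomes the
common factor \<open>rGamma (c + of_nat N)\<close> times a Pochhammer symbol that starts at a point depending on \<open>k\<close>, and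
reading that symbol backwards moves its start to the fixed point \<open>1 - c - of_nat N\<close>.
\<close>
lemma pochhammer_reflect_end:
  fixes c :: complex
  assumes "k \<le> N"
  shows "pochhammer (1 - c - of_nat N) (N - k) = (- 1) ^ (N - k) * pochhammer (c + of_nat k) (N - k)"
proof -
  have "1 - c - of_nat N = - (c + of_nat N - 1)" by simp
  also have "pochhammer \<dots> (N - k) = (- 1) ^ (N - k) * pochhammer (c + of_nat N - 1 - of_nat (N - k) + 1) (N - k)"
    by (rule pochhammer_minus)
  also have "c + of_nat N - 1 - of_nat (N - k) + 1 = c + of_nat k" using assms by (simp add: of_nat_diff)
  finally show ?thesis .
qed

lemma rGamma_shift_diff:
  fixes c :: complex
  assumes "k \<le> N"
  shows "rGamma (c + of_nat k) = pochhammer (c + of_nat k) (N - k) * rGamma (c + of_nat N)"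
  using pochhammer_rGamma[of "c + of_nat k" "N - k"] assms by (simp add: of_nat_diff add_ac)

section \<open>Pfaff and quadratic transformations near the origin\<close>

lemma hyp_coeff_1_1: "hyp_coeff a 1 1 n = pochhammer a n / fact n"
  by (simp add: hyp_coeff_def rGamma_inverse_Gamma Gamma_fact field_simps flip: pochhammer_fact)

lemma sum_inverse_fact_fact:
  "(\<Sum>k\<le>N. 1 / (fact k * fact (N - k))) = (2 ^ N / fact N :: real)"
proof -
  have "(2::real) ^ N = (\<Sum>k\<le>N. of_nat (N choose k))"
    using binomial_ring[of "1::real" 1 N] by simp
  also have "\<dots> = (\<Sum>k\<le>N. fact N * (1 / (fact k * fact (N - k))))"
    by (rule sum.cong) (simp_all add: binomial_fact)
  finally have "(2::real) ^ N = fact N * (\<Sum>k\<le>N. 1 / (fact k * fact (N - k)))"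
    by (simp only: sum_distrib_left)
  thus ?thesis by (simp add: field_simps)
qed

lemma powr_minus_add_nat:
  fixes w p :: complex
  assumes "w \<noteq> 0"
  shows "w powr (- (p + of_nat k)) = w powr (- p) / w ^ k"
  using assms by (simp add: powr_diff powr_nat' flip: diff_conv_add_uminus)

text \<open>
On this half-plane \<open>z\<close> is nearer to \<open>0\<close> than to \<open>1\<close>.
\<close>
lemma norm_pfaff_less_1:
  fixes z :: complex
  assumes "Re z < 1 / 2"
  shows "norm (z / (z - 1)) < 1"
proof -
  have "(norm z)\<^sup>2 < (norm (z - 1))\<^sup>2"
    unfolding cmod_power2 using assms by (simp add: power2_eq_square algebra_simps)
  hence "norm z < norm (z - 1)" by (rule power2_less_imp_less) simp
  moreover from this have "z \<noteq> 1" by auto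
  ultimately show ?thesis by (simp add: norm_divide divide_less_eq)
qed

text \<open>
Pfaff's transformation for small \<open>z\<close>. Expanding each \<open>(1 - z) powr (- a - k)\<close> on the right by the binomial
series gives a double series whose \<open>N\<close>-th diagonal is a Vandermonde sum, equal to the \<open>N\<close>-th term
on the left. The radius \<open>1/4\<close> comes only from crude bounds; analytic continuation removes it
later.
\<close>
lemma pfaff_near_0:
  assumes z: "norm z < 1 / 4"
  shows "hypergeo_reg_series a b c z = (1 - z) powr (- a) * hypergeo_reg_series a (c - b) c (z / (z - 1))"
proof -
  define g where "g k j = (hyp_coeff a (c - b) c k * (- z) ^ k) * (pochhammer (a + of_nat k) j / fact j * z ^ j)" for k j
  define r where "r k = (hyp_coeff a (c - b) c k * (- z) ^ k) * (1 - z) powr (- (a + of_nat k))" for k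
  have "1 - z \<noteq> 0" using z by auto
  have g_diag: "g k (N - k) = pochhammer a N * z ^ N * (- 1) ^ k * pochhammer (c - b) k * rGamma (c + of_nat k) / (fact k * fact (N - k))"
    if "k \<le> N" for k N
  proof -
    have "z ^ N = z ^ k * z ^ (N - k)" using that by (simp flip: power_add)
    moreover have "pochhammer a N = pochhammer a k * pochhammer (a + of_nat k) (N - k)"
      by (rule pochhammer_product[OF that])
    ultimately show ?thesis by (simp add: g_def hyp_coeff_def power_minus[of z])
  qed
  have "(\<Sum>k\<le>N. g k (N - k)) = hyp_coeff a b c N * z ^ N" for N
  proof -
    have "(\<Sum>k\<le>N. g k (N - k)) = (\<Sum>k\<le>N. pochhammer a N * z ^ N * (- 1) ^ N * rGamma (c + of_nat N) *
             (pochhammer (c - b) k * pochhammer (1 - c - of_nat N) (N - k) / (fact k * fact (N - k))))"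
    proof (rule sum.cong)
      fix k assume "k \<in> {..N}"
      hence k: "k \<le> N" by simp
      have sgn: "(- 1 :: complex) ^ N * (- 1) ^ (N - k) = (- 1) ^ k"
        using k by (auto simp: minus_one_power_iff)
      show "g k (N - k) = pochhammer a N * z ^ N * (- 1) ^ N * rGamma (c + of_nat N) *
             (pochhammer (c - b) k * pochhammer (1 - c - of_nat N) (N - k) / (fact k * fact (N - k)))"
        unfolding g_diag[OF k] pochhammer_reflect_end[OF k] rGamma_shift_diff[OF k, of c] sgn[symmetric]
        by simp
    qed simp
    also have "\<dots> = pochhammer a N * z ^ N * (- 1) ^ N * rGamma (c + of_nat N) * (pochhammer (1 - b - of_nat N) N / fact N)"
      unfolding sum_distrib_left[symmetric] vandermonde_fact by (simp add: algebra_simps)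
    also have "\<dots> = hyp_coeff a b c N * z ^ N"
      using pochhammer_reflect_end[of 0 N b] by (simp add: hyp_coeff_def flip: power_mult_distrib)
    finally show ?thesis .
  qed
  hence diag: "(\<lambda>N. \<Sum>k\<le>N. g k (N - k)) sums hypergeo_reg_series a b c z"
    using hypergeo_reg_series_sums[of z a b c] z by simp
  have rows: "g k sums r k" for k
    unfolding g_def r_def by (intro sums_mult binomial_series_sums) (use z in simp)
  obtain B where B: "\<And>N. (\<Sum>k\<le>N. norm (g k (N - k))) \<le> B N" "summable B"
  proof -
    obtain C where C: "C > 0" "\<And>n. norm (hyp_coeff (c - b) 1 c n) \<le> C * 2 ^ n"
      using hyp_coeff_bound[of "c - b" 1 c] by blast
    have bd: "norm (pochhammer (c - b) k * rGamma (c + of_nat k)) \<le> C * 2 ^ k" for k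
      using C(2)[of k] by (simp add: hyp_coeff_def flip: pochhammer_fact)
    have "(\<Sum>k\<le>N. norm (g k (N - k))) \<le> C * norm (hyp_coeff (of_real (norm a)) 1 1 N * (4 * z) ^ N)" for N
    proof -
      have "norm (g k (N - k)) \<le> C * pochhammer (norm a) N * (2 * norm z) ^ N * (1 / (fact k * fact (N - k)))" if k: "k \<le> N" for k
      proof -
        have "norm (pochhammer (c - b) k * rGamma (c + of_nat k)) \<le> C * 2 ^ N"
          using bd[of k] C(1) k by (smt (verit) mult_left_mono power_increasing)
        hence "norm (pochhammer a N) * norm z ^ N * norm (pochhammer (c - b) k * rGamma (c + of_nat k)) \<le>
          pochhammer (norm a) N * norm z ^ N * (C * 2 ^ N)"
          using norm_pochhammer_le[of a N] order_trans[OF norm_ge_zero norm_pochhammer_le, of a N]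
          by (intro mult_mono) auto
        thus ?thesis unfolding g_diag[OF k]
          by (simp add: norm_mult norm_divide norm_power power_mult_distrib divide_right_mono mult_ac)
      qed
      hence "(\<Sum>k\<le>N. norm (g k (N - k))) \<le> (\<Sum>k\<le>N. C * pochhammer (norm a) N * (2 * norm z) ^ N * (1 / (fact k * fact (N - k))))"
        by (intro sum_mono) simp
      also have "\<dots> = C * (pochhammer (norm a) N / fact N * (4 * norm z) ^ N)"
        unfolding sum_distrib_left[symmetric] sum_inverse_fact_fact
        using power_mult_distrib[of "2::real" 2 N] by (auto simp: power_mult_distrib)
      also have "pochhammer (norm a) N = norm (pochhammer (of_real (norm a)) N :: complex)"
        by (simp add: pochhammer_of_real) (metis abs_of_nonneg norm_ge_zero norm_pochhammer_le order_trans)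
      finally show ?thesis by (simp add: hyp_coeff_1_1 norm_mult norm_divide norm_power)
    qed
    moreover have "summable (\<lambda>N. C * norm (hyp_coeff (of_real (norm a)) 1 1 N * (4 * z) ^ N))"
      by (intro summable_mult hyp_coeff_summable) (use z in \<open>simp add: norm_mult\<close>)
    ultimately show ?thesis by (rule that)
  qed
  have "r sums hypergeo_reg_series a b c z" by (rule diagonal_sums[OF B diag rows])
  moreover have "r sums ((1 - z) powr (- a) * hypergeo_reg_series a (c - b) c (z / (z - 1)))"
  proof -
    have "r = (\<lambda>k. (1 - z) powr (- a) * (hyp_coeff a (c - b) c k * (z / (z - 1)) ^ k))"
    proof
      fix k
      have "z / (z - 1) = (- z) / (1 - z)" by (metis minus_diff_eq minus_divide_divide)
      hence "(z / (z - 1)) ^ k = (- z) ^ k / (1 - z) ^ k" by (simp only: power_divide)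
      thus "r k = (1 - z) powr (- a) * (hyp_coeff a (c - b) c k * (z / (z - 1)) ^ k)"
        unfolding r_def powr_minus_add_nat[OF \<open>1 - z \<noteq> 0\<close>] by simp
    qed
    moreover have "Re z < 1 / 2" using z complex_Re_le_cmod[of z] by linarith
    hence "norm (z / (z - 1)) < 1" by (rule norm_pfaff_less_1)
    ultimately show ?thesis by (simp only:) (intro sums_mult hypergeo_reg_series_sums)
  qed
  ultimately show ?thesis by (rule sums_unique2)
qed

lemma fact_add_le: "fact (m + n) \<le> (2 ^ (m + n) * fact m * fact n :: real)"
proof -
  have "real ((m + n) choose m) \<le> 2 ^ (m + n)"
    using binomial_le_pow2[of "m + n" m] by (metis of_nat_le_iff of_nat_numeral of_nat_power)
  moreover have "real ((m + n) choose m) = fact (m + n) / (fact m * fact n)"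
    by (simp add: binomial_fact)
  ultimately show ?thesis by (simp add: field_simps)
qed

text \<open>
A quadratic transformation of Gauss for small \<open>u\<close>, by the same method. The duplication formula
merges the two Pochhammer symbols on the right into \<open>pochhammer (2 * a) (2 * k)\<close>, which combines with the binomial
expansion of \<open>(1 + u) powr (- 2 * a - 2 * k)\<close> to \<open>pochhammer (2 * a) (N + k)\<close>. In this particular
variable the diagonals are again Vandermonde sums; an expansion in powers of \<open>4 * t * (1 - t)\<close>
would require a Saalschuetz sum instead. The radius \<open>1/64\<close> again comes only from crude bounds.
\<close>
lemma quadratic_near_0:
  assumes u: "norm u < 1 / 64"
  shows "hypergeo_reg_series (2 * a) (2 * a - c + 1) c u =
           (1 + u) powr (- 2 * a) * hypergeo_reg_series a (a + 1 / 2) c (4 * u / (1 + u)\<^sup>2)"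
proof -
  define g where "g k j = (hyp_coeff a (a + 1 / 2) c k * (4 * u) ^ k) * (pochhammer (2 * a + of_nat (2 * k)) j / fact j * (- u) ^ j)" for k j
  define r where "r k = (hyp_coeff a (a + 1 / 2) c k * (4 * u) ^ k) * (1 - (- u)) powr (- (2 * a + of_nat (2 * k)))" for k
  have "1 + u \<noteq> 0" using u by (auto simp: add_eq_0_iff)
  have g_diag: "g k (N - k) = u ^ N * (- 1) ^ (N - k) * pochhammer (2 * a) (N + k) * rGamma (c + of_nat k) / (fact k * fact (N - k))"
    if "k \<le> N" for k N
  proof -
    have "u ^ N = u ^ k * u ^ (N - k)" using that by (simp flip: power_add)
    moreover have "pochhammer (2 * a) (N + k) = pochhammer (2 * a) (2 * k) * pochhammer (2 * a + of_nat (2 * k)) (N - k)"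
      using pochhammer_product'[of "2 * a" "2 * k" "N - k"] that by (simp only: mult_2 add.assoc le_add_diff_inverse add.commute[of N])
    moreover have "pochhammer (2 * a) (2 * k) = 4 ^ k * pochhammer a k * pochhammer (a + 1 / 2) k"
      by (simp add: pochhammer_double power_mult)
    ultimately show ?thesis by (simp add: g_def hyp_coeff_def power_minus[of u] power_mult_distrib)
  qed
  have "(\<Sum>k\<le>N. g k (N - k)) = hyp_coeff (2 * a) (2 * a - c + 1) c N * u ^ N" for N
  proof -
    have "(\<Sum>k\<le>N. g k (N - k)) = (\<Sum>k\<le>N. u ^ N * pochhammer (2 * a) N * rGamma (c + of_nat N) *
             (pochhammer (2 * a + of_nat N) k * pochhammer (1 - c - of_nat N) (N - k) / (fact k * fact (N - k))))"
    proof (rule sum.cong)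
      fix k assume "k \<in> {..N}"
      hence k: "k \<le> N" by simp
      show "g k (N - k) = u ^ N * pochhammer (2 * a) N * rGamma (c + of_nat N) *
             (pochhammer (2 * a + of_nat N) k * pochhammer (1 - c - of_nat N) (N - k) / (fact k * fact (N - k)))"
        unfolding g_diag[OF k] pochhammer_reflect_end[OF k] rGamma_shift_diff[OF k, of c] pochhammer_product'
        by simp
    qed simp
    also have "\<dots> = u ^ N * pochhammer (2 * a) N * rGamma (c + of_nat N) * (pochhammer (2 * a - c + 1) N / fact N)"
      unfolding sum_distrib_left[symmetric] vandermonde_fact by (simp add: algebra_simps)
    also have "\<dots> = hyp_coeff (2 * a) (2 * a - c + 1) c N * u ^ N" by (simp add: hyp_coeff_def)
    finally show ?thesis .
  qed
  hence diag: "(\<lambda>N. \<Sum>k\<le>N. g k (N - k)) sums hypergeo_reg_series (2 * a) (2 * a - c + 1) c u"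
    using hypergeo_reg_series_sums[of u "2 * a" "2 * a - c + 1" c] u by simp
  have rows: "g k sums r k" for k
    unfolding g_def r_def by (intro sums_mult binomial_series_sums) (use u in simp)
  obtain B where B: "\<And>N. (\<Sum>k\<le>N. norm (g k (N - k))) \<le> B N" "summable B"
  proof -
    obtain C where C: "C > 0" "\<And>n. norm (hyp_coeff (2 * a) 1 1 n) \<le> C * 2 ^ n"
      using hyp_coeff_bound[of "2 * a" 1 1] by blast
    obtain D where D: "D > 0" "\<And>n. norm (hyp_coeff 1 1 c n) \<le> D * 2 ^ n"
      using hyp_coeff_bound[of "1" 1 c] by blast
    have "(\<Sum>k\<le>N. norm (g k (N - k))) \<le> C * D * (64 * norm u) ^ N" for N
    proof -
      have "norm (g k (N - k)) \<le> C * D * (32 * norm u) ^ N * fact N * (1 / (fact k * fact (N - k)))" if k: "k \<le> N" for k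
      proof -
        have "norm (pochhammer (2 * a) (N + k)) \<le> C * 2 ^ (N + k) * fact (N + k)"
          using C(2)[of "N + k"] by (simp add: hyp_coeff_1_1 norm_divide field_simps)
        also have "\<dots> \<le> C * 2 ^ (N + k) * (2 ^ (N + k) * fact N * fact k)"
          using C(1) by (intro mult_left_mono fact_add_le) simp
        also have "\<dots> = C * 4 ^ (N + k) * fact N * fact k"
          using power_mult_distrib[of "2::real" 2 "N + k"] by simp
        also have "\<dots> \<le> C * 4 ^ (N + N) * fact N * fact k"
          using k C(1) by (intro mult_right_mono mult_left_mono power_increasing) auto
        finally have P: "norm (pochhammer (2 * a) (N + k)) \<le> C * 16 ^ N * fact N * fact k"
          using power_mult_distrib[of "4::real" 4 N] by (simp add: power_add)
        have "norm (rGamma (c + of_nat k)) * fact k \<le> D * 2 ^ k"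
          using D(2)[of k] by (simp add: hyp_coeff_def norm_mult mult_ac flip: pochhammer_fact)
        also have "\<dots> \<le> D * 2 ^ N" using k D(1) by simp
        finally have Q: "norm (rGamma (c + of_nat k)) * fact k \<le> D * 2 ^ N" .
        have "norm (pochhammer (2 * a) (N + k)) * norm (rGamma (c + of_nat k)) \<le>
               (C * 16 ^ N * fact N) * (norm (rGamma (c + of_nat k)) * fact k)"
          using mult_right_mono[OF P, of "norm (rGamma (c + of_nat k))"] by (simp add: mult_ac)
        also have "\<dots> \<le> (C * 16 ^ N * fact N) * (D * 2 ^ N)"
          using Q C(1) by (intro mult_left_mono) auto
        also have "\<dots> = C * D * 32 ^ N * fact N"
          using power_mult_distrib[of "16::real" 2 N] by simp
        finally have "norm u ^ N * (norm (pochhammer (2 * a) (N + k)) * norm (rGamma (c + of_nat k))) \<le> norm u ^ N * (C * D * 32 ^ N * fact N)"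
          by (intro mult_left_mono) auto
        thus ?thesis unfolding g_diag[OF k]
          by (simp add: norm_mult norm_divide norm_power power_mult_distrib divide_right_mono mult_ac)
      qed
      hence "(\<Sum>k\<le>N. norm (g k (N - k))) \<le> (\<Sum>k\<le>N. C * D * (32 * norm u) ^ N * fact N * (1 / (fact k * fact (N - k))))"
        by (intro sum_mono) simp
      also have "\<dots> = C * D * (64 * norm u) ^ N"
        unfolding sum_distrib_left[symmetric] sum_inverse_fact_fact
        using power_mult_distrib[of "32::real" 2 N] by (auto simp: power_mult_distrib)
      finally show ?thesis .
    qed
    moreover have "summable (\<lambda>N. C * D * (64 * norm u) ^ N)"
      by (intro summable_mult summable_geometric) (use u in simp)
    ultimately show ?thesis by (rule that)
  qed
  have "r sums hypergeo_reg_series (2 * a) (2 * a - c + 1) c u" by (rule diagonal_sums[OF B diag rows])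
  moreover have "r sums ((1 + u) powr (- 2 * a) * hypergeo_reg_series a (a + 1 / 2) c (4 * u / (1 + u)\<^sup>2))"
  proof -
    have "r = (\<lambda>k. (1 + u) powr (- 2 * a) * (hyp_coeff a (a + 1 / 2) c k * (4 * u / (1 + u)\<^sup>2) ^ k))"
    proof
      show "r k = (1 + u) powr (- 2 * a) * (hyp_coeff a (a + 1 / 2) c k * (4 * u / (1 + u)\<^sup>2) ^ k)" for k
        using powr_minus_add_nat[OF \<open>1 + u \<noteq> 0\<close>, of "2 * a" "2 * k"]
        by (simp add: r_def power_divide power_mult)
    qed
    moreover have "norm (4 * u / (1 + u)\<^sup>2) < 1"
    proof -
      have "1 - norm u \<le> norm (1 + u)" using norm_triangle_ineq2[of 1 "- u"] by simp
      hence "1 / 2 < norm (1 + u)" using u by linarith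
      hence "(1 / 2)\<^sup>2 < (norm (1 + u))\<^sup>2" by (intro power_strict_mono) auto
      thus ?thesis using u by (simp add: norm_divide norm_mult norm_power power2_eq_square divide_less_eq)
    qed
    ultimately show ?thesis
      by (simp only:) (intro sums_mult hypergeo_reg_series_sums)
  qed
  ultimately show ?thesis by (rule sums_unique2)
qed

section \<open>Analytic continuation to a half-plane\<close>

text \<open>
The region reached by the power series together with its Pfaff transform. It contains every real number below \<open>1\<close>
and is star-shaped about \<open>0\<close>.
\<close>
definition hyp_domain :: "complex set" where
  "hyp_domain = ball 0 1 \<union> {z. Re z < 1 / 2}"

lemma convex_Re_less: "convex {z. Re z < r}"
  using convex_halfspace_Re_lt[of r] by simp

lemma open_Re_less: "open {z. Re z < r}"
  using open_halfspace_Re_lt[of r] by simp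

lemma open_hyp_domain: "open hyp_domain"
  unfolding hyp_domain_def by (intro open_Un open_ball open_Re_less)

lemma closed_segment_subset_hyp_domain:
  assumes "u \<in> hyp_domain"
  shows "closed_segment 0 u \<subseteq> hyp_domain"
proof -
  have "closed_segment 0 u \<subseteq> S" if "convex S" "0 \<in> S" "u \<in> S" for S :: "complex set"
    using that by (rule closed_segment_subset[rotated 2])
  from this[OF convex_ball[of 0 1]] this[OF convex_Re_less[of "1 / 2"]] assms show ?thesis
    unfolding hyp_domain_def Un_iff by (elim disjE) (simp_all add: le_supI1 le_supI2)
qed

lemma connected_hyp_domain: "connected hyp_domain"
proof -
  have "0 \<in> hyp_domain" by (simp add: hyp_domain_def)
  hence "starlike hyp_domain"
    unfolding starlike_def using closed_segment_subset_hyp_domain by blast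
  thus ?thesis by (rule starlike_imp_connected)
qed

lemma hyp_domain_cut:
  assumes "z \<in> hyp_domain"
  shows "1 - z \<notin> \<real>\<^sub>\<le>\<^sub>0"
proof
  assume "1 - z \<in> \<real>\<^sub>\<le>\<^sub>0"
  hence "Re z \<ge> 1" by (auto simp: complex_nonpos_Reals_iff)
  moreover from this have "norm z \<ge> 1" using complex_Re_le_cmod[of z] by linarith
  ultimately show False using assms by (auto simp: hyp_domain_def)
qed

lemma holomorphic_pfaff:
  "(\<lambda>z. (1 - z) powr (- a) * hypergeo_reg_series a (c - b) c (z / (z - 1))) holomorphic_on {z. Re z < 1 / 2}"
proof -
  have "(hypergeo_reg_series a (c - b) c \<circ> (\<lambda>z. z / (z - 1))) holomorphic_on {z. Re z < 1 / 2}"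
  proof (rule holomorphic_on_compose_gen)
    show "(\<lambda>z. z / (z - 1)) holomorphic_on {z. Re z < 1 / 2}"
      by (intro holomorphic_intros) auto
    show "(\<lambda>z. z / (z - 1)) ` {z. Re z < 1 / 2} \<subseteq> ball 0 1"
      using norm_pfaff_less_1 by auto
  qed (rule holomorphic_hypergeo_reg_series)
  thus ?thesis unfolding o_def
    by (intro holomorphic_intros) (auto simp: complex_nonpos_Reals_iff)
qed

lemma pfaff_series:
  assumes "norm z < 1" "Re z < 1 / 2"
  shows "hypergeo_reg_series a b c z = (1 - z) powr (- a) * hypergeo_reg_series a (c - b) c (z / (z - 1))"
proof (rule analytic_continuation_open[where s = "ball 0 (1 / 4)" and s' = "ball 0 1 \<inter> {z. Re z < 1 / 2}"
        and f = "hypergeo_reg_series a b c" and z = z])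
  show "connected (ball 0 1 \<inter> {z. Re z < 1 / 2})"
    by (intro convex_connected convex_Int convex_ball convex_Re_less)
  show "ball 0 (1 / 4) \<subseteq> ball 0 1 \<inter> {z. Re z < 1 / 2}"
  proof
    fix x :: complex assume "x \<in> ball 0 (1 / 4)"
    thus "x \<in> ball 0 1 \<inter> {z. Re z < 1 / 2}" using complex_Re_le_cmod[of x] by simp
  qed
  show "hypergeo_reg_series a b c holomorphic_on ball 0 1 \<inter> {z. Re z < 1 / 2}"
    by (rule holomorphic_on_subset[OF holomorphic_hypergeo_reg_series]) simp
  show "(\<lambda>z. (1 - z) powr (- a) * hypergeo_reg_series a (c - b) c (z / (z - 1))) holomorphic_on
          ball 0 1 \<inter> {z. Re z < 1 / 2}"
    by (rule holomorphic_on_subset[OF holomorphic_pfaff]) simp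
  show "open (ball 0 1 \<inter> {z. Re z < 1 / 2})" by (intro open_Int open_ball open_Re_less)
qed (use assms in \<open>auto intro!: pfaff_near_0\<close>)

text \<open>
The series on the disc and its Pfaff transform on the half-plane agree on their overlap, so they
glue to one holomorphic function, which has to be the analytic continuation.
\<close>
lemma hypergeo_reg_continuation:
  shows "hypergeo_reg a b c holomorphic_on hyp_domain"
    and "\<And>z. norm z < 1 \<Longrightarrow> hypergeo_reg a b c z = hypergeo_reg_series a b c z"
    and "\<And>z. Re z < 1 / 2 \<Longrightarrow>
      hypergeo_reg a b c z = (1 - z) powr (- a) * hypergeo_reg_series a (c - b) c (z / (z - 1))"
proof -
  define f where "f z = (if z \<in> ball 0 1 then hypergeo_reg_series a b c z
      else (1 - z) powr (- a) * hypergeo_reg_series a (c - b) c (z / (z - 1)))" for z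
  have f: "f holomorphic_on hyp_domain"
    unfolding f_def hyp_domain_def
    by (rule holomorphic_on_If_Un[OF holomorphic_hypergeo_reg_series holomorphic_pfaff open_ball open_Re_less])
       (auto intro: pfaff_series)
  have eq: "hypergeo_reg a b c z = f z" if "z \<in> hyp_domain" for z
    using open_hyp_domain closed_segment_subset_hyp_domain _ that f
    by (rule hypergeo_reg_eqI) (auto simp: hyp_domain_def f_def)
  show "hypergeo_reg a b c holomorphic_on hyp_domain"
    using f by (rule holomorphic_transform) (simp add: eq)
  show "hypergeo_reg a b c z = hypergeo_reg_series a b c z" if "norm z < 1" for z
    using eq[of z] that by (simp add: hyp_domain_def f_def)
  show "hypergeo_reg a b c z = (1 - z) powr (- a) * hypergeo_reg_series a (c - b) c (z / (z - 1))"
    if "Re z < 1 / 2" for z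
    using eq[of z] that pfaff_series[of z a b c] by (auto simp: hyp_domain_def f_def)
qed

section \<open>The quadratic transformation\<close>

lemma Ln_divide_Re_pos:
  assumes "Re s > 0" "Re w > 0"
  shows "Ln (s / w) = Ln s - Ln w"
proof (rule Ln_unique)
  have nz: "s \<noteq> 0" "w \<noteq> 0" using assms by auto
  show "exp (Ln s - Ln w) = s / w" using nz by (simp add: exp_diff)
  have "\<bar>Im (Ln s)\<bar> < pi / 2" "\<bar>Im (Ln w)\<bar> < pi / 2"
    using assms Re_Ln_pos_lt[OF nz(1)] Re_Ln_pos_lt[OF nz(2)] by blast+
  thus "- pi < Im (Ln s - Ln w)" "Im (Ln s - Ln w) \<le> pi" by simp_all
qed

lemma Re_csqrt_pos:
  assumes "v \<notin> \<real>\<^sub>\<le>\<^sub>0"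
  shows "Re (csqrt v) > 0"
proof (rule ccontr)
  assume "\<not> Re (csqrt v) > 0"
  hence "Re (csqrt v) = 0" using csqrt_principal[of v] by linarith
  hence "csqrt v = \<i> * of_real (Im (csqrt v))" by (simp add: complex_eq_iff)
  hence "v = (\<i> * of_real (Im (csqrt v)))\<^sup>2" by (metis power2_csqrt)
  hence "v = of_real (- (Im (csqrt v))\<^sup>2)" by (simp add: power_mult_distrib)
  moreover have "of_real (- (Im (csqrt v))\<^sup>2) \<in> (\<real>\<^sub>\<le>\<^sub>0 :: complex set)" by (simp add: complex_nonpos_Reals_iff)
  ultimately show False using assms by metis
qed

lemma Ln_eq_2_Ln_csqrt:
  assumes "v \<noteq> 0"
  shows "Ln v = 2 * Ln (csqrt v)"
proof -
  have "Ln (csqrt v) = Ln v / 2"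
    using mpi_less_Im_Ln[OF assms] Im_Ln_le_pi[OF assms]
    by (intro Ln_unique) (simp_all add: csqrt_exp_Ln assms)
  hence "Ln (csqrt v) * 2 = Ln v" by simp
  thus ?thesis by (metis mult.commute)
qed

lemma norm_1_minus_csqrt_le:
  assumes "z \<in> hyp_domain"
  shows "norm (1 - csqrt (1 - z)) \<le> norm z"
proof -
  define s where "s = csqrt (1 - z)"
  have "Re s > 0" unfolding s_def by (intro Re_csqrt_pos hyp_domain_cut assms)
  hence "norm (1 + s) \<ge> 1" using complex_Re_le_cmod[of "1 + s"] by simp
  moreover have "s\<^sup>2 = 1 - z" by (simp add: s_def)
  hence "z = (1 - s) * (1 + s)" by (simp add: power2_eq_square algebra_simps)
  hence "norm z = norm (1 - s) * norm (1 + s)" by (simp only: norm_mult)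
  ultimately show ?thesis by (simp add: s_def mult_le_cancel_left1)
qed

text \<open>
With \<open>s = csqrt (1 - z)\<close> and \<open>t = (1 - s) / 2\<close>, one has \<open>z = 4 * t * (1 - t)\<close>. Pfaff's transformation applied at \<open>t\<close> leads to the variable
\<open>u = t / (t - 1)\<close>, the quadratic transformation then leads to
\<open>4 * u / (1 + u)\<^sup>2 = z / (z - 1)\<close>, and this is where Pfaff's transformation applied at \<open>z\<close> arrives too.
The bound \<open>1/100\<close> makes \<open>norm u\<close> smaller than \<open>1/64\<close>.
\<close>
lemma quadratic_csqrt_near_0:
  assumes z: "norm z < 1 / 100"
  defines "s \<equiv> csqrt (1 - z)"
  shows "hypergeo_reg_series (b - a + 1 / 2) (a - b + 1 / 2) (a + b + 1 / 2) ((1 - s) / 2) =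
           ((1 + s) / 2) powr (a + b - 1 / 2) * hypergeo_reg_series a b (a + b + 1 / 2) z"
proof -
  define t where "t = (1 - s) / 2"
  define u where "u = t / (t - 1)"
  have "z \<in> hyp_domain" using z by (auto simp: hyp_domain_def)
  hence s_pos: "Re s > 0" unfolding s_def by (intro Re_csqrt_pos hyp_domain_cut)
  have s2: "s\<^sup>2 = 1 - z" by (simp add: s_def)
  hence z_eq: "z = (1 - s) * (1 + s)" by (simp add: power2_eq_square algebra_simps)
  have "norm (1 - s) \<le> norm z" unfolding s_def by (rule norm_1_minus_csqrt_le) fact
  hence t: "norm t < 1 / 200" using z by (simp add: t_def norm_divide)
  have t1: "norm (t - 1) > 199 / 200" using t norm_triangle_ineq2[of 1 t] by (simp add: norm_minus_commute)
  hence "norm u < 1 / 64" using t by (simp add: u_def norm_divide divide_less_eq)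
  have nz: "s \<noteq> 0" "t \<noteq> 1" "s + 1 \<noteq> 0" using s_pos t1 by (auto simp: add_eq_0_iff2)
  have t_1: "t - 1 = - ((1 + s) / 2)" by (simp add: t_def field_simps)
  have u1: "1 + u = s / ((1 + s) / 2)"
  proof -
    have "1 + u = (2 * t - 1) / (t - 1)" using nz by (simp add: u_def field_simps)
    also have "2 * t - 1 = - s" by (simp add: t_def field_simps)
    finally show ?thesis unfolding t_1 by simp
  qed
  have uz: "4 * u / (1 + u)\<^sup>2 = z / (z - 1)"
  proof -
    have "u = ((1 - s) / 2) / (- ((1 + s) / 2))" unfolding u_def t_1 by (simp only: t_def)
    also have "\<dots> = - (((1 - s) / 2) / ((1 + s) / 2))" by (rule minus_divide_right[symmetric])
    also have "\<dots> = - ((1 - s) / (1 + s))"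
    proof -
      have "(x / 2) / (y / 2) = x / y" for x y :: complex by simp
      thus ?thesis by (simp only:)
    qed
    finally have "u = - ((1 - s) / (1 + s))" .
    moreover have "z - 1 = - s\<^sup>2" using s2 by simp
    hence "z / (z - 1) = - ((1 - s) * (1 + s) / s\<^sup>2)" unfolding z_eq[symmetric] by simp
    moreover have "4 * (- (q / p)) / (s / (p / 2))\<^sup>2 = - (q * p / s\<^sup>2)" if "p \<noteq> 0" for p q :: complex
      using that nz(1) by (simp add: power2_eq_square field_simps)
    ultimately show ?thesis using nz(3) unfolding u1 by (simp only: add.commute[of s])
  qed
  have "hypergeo_reg_series (b - a + 1 / 2) (a - b + 1 / 2) (a + b + 1 / 2) t =
        hypergeo_reg_series (a - b + 1 / 2) (b - a + 1 / 2) (a + b + 1 / 2) t"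
    by (rule hypergeo_reg_series_commute)
  also have "\<dots> = (1 - t) powr (- (a - b + 1 / 2)) *
        hypergeo_reg_series (a - b + 1 / 2) (2 * a) (a + b + 1 / 2) u"
    unfolding u_def using t by (subst pfaff_near_0) (simp_all add: algebra_simps)
  also have "hypergeo_reg_series (a - b + 1 / 2) (2 * a) (a + b + 1 / 2) u =
             hypergeo_reg_series (2 * a) (2 * a - (a + b + 1 / 2) + 1) (a + b + 1 / 2) u"
    by (subst hypergeo_reg_series_commute) (simp add: algebra_simps)
  also have "\<dots> = (1 + u) powr (- 2 * a) * hypergeo_reg_series a (a + 1 / 2) (a + b + 1 / 2) (z / (z - 1))"
    unfolding uz[symmetric] by (rule quadratic_near_0) fact
  finally have 1: "hypergeo_reg_series (b - a + 1 / 2) (a - b + 1 / 2) (a + b + 1 / 2) t =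
      (1 - t) powr (- (a - b + 1 / 2)) * ((1 + u) powr (- 2 * a) *
      hypergeo_reg_series a (a + 1 / 2) (a + b + 1 / 2) (z / (z - 1)))" .
  have 2: "hypergeo_reg_series a b (a + b + 1 / 2) z =
      (1 - z) powr (- a) * hypergeo_reg_series a (a + 1 / 2) (a + b + 1 / 2) (z / (z - 1))"
    using z by (subst pfaff_near_0) (simp_all add: algebra_simps)
  have 3: "1 - t = (1 + s) / 2" by (simp add: t_def field_simps)
  have 4: "((1 + s) / 2) powr (- (a - b + 1 / 2)) * (1 + u) powr (- 2 * a) =
      ((1 + s) / 2) powr (a + b - 1 / 2) * (1 - z) powr (- a)"
  proof -
    have "Ln (1 + u) = Ln s - Ln ((1 + s) / 2)" unfolding u1
      by (rule Ln_divide_Re_pos) (use s_pos in auto)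
    moreover have "1 - z \<noteq> 0" using z by auto
    hence "Ln (1 - z) = 2 * Ln s" unfolding s_def by (rule Ln_eq_2_Ln_csqrt)
    moreover have "1 + u \<noteq> 0" "(1 + s) / 2 \<noteq> 0" using nz by (simp_all add: u1 add.commute)
    ultimately have "((1 + s) / 2) powr (- (a - b + 1 / 2)) * (1 + u) powr (- 2 * a) =
        exp (- (a - b + 1 / 2) * Ln ((1 + s) / 2) + - 2 * a * (Ln s - Ln ((1 + s) / 2)))"
      "((1 + s) / 2) powr (a + b - 1 / 2) * (1 - z) powr (- a) =
        exp ((a + b - 1 / 2) * Ln ((1 + s) / 2) + - a * (2 * Ln s))"
      using \<open>1 - z \<noteq> 0\<close> by (simp_all only: powr_def if_False exp_add)
    thus ?thesis by (simp add: algebra_simps)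
  qed
  show ?thesis
    unfolding t_def[symmetric] 1 2 3 by (simp only: mult.assoc[symmetric] 4)
qed

text \<open>
Continuation to the whole region. Taking \<open>z\<close> as the variable and \<open>s = csqrt (1 - z)\<close> as a function of it makes
connectedness immediate, and \<open>Re s > 0\<close> puts \<open>(1 - s) / 2\<close> into the half-plane, where the left-hand
side is holomorphic.
\<close>
lemma quadratic_transformation:
  assumes "z \<in> hyp_domain"
  shows "hypergeo_reg (b - a + 1 / 2) (a - b + 1 / 2) (a + b + 1 / 2) ((1 - csqrt (1 - z)) / 2) =
           ((1 + csqrt (1 - z)) / 2) powr (a + b - 1 / 2) * hypergeo_reg a b (a + b + 1 / 2) z"
proof (rule analytic_continuation_open[where s = "ball 0 (1 / 100)" and s' = hyp_domain and z = z
      and f = "\<lambda>z. hypergeo_reg (b - a + 1 / 2) (a - b + 1 / 2) (a + b + 1 / 2) ((1 - csqrt (1 - z)) / 2)"])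
  have sqrt_hol: "(\<lambda>z. csqrt (1 - z)) holomorphic_on hyp_domain"
    by (intro holomorphic_intros) (rule hyp_domain_cut)
  have half: "Re ((1 - csqrt (1 - z)) / 2) < 1 / 2" if "z \<in> hyp_domain" for z
    using Re_csqrt_pos[OF hyp_domain_cut[OF that]] by simp
  have "(hypergeo_reg (b - a + 1 / 2) (a - b + 1 / 2) (a + b + 1 / 2) \<circ> (\<lambda>z. (1 - csqrt (1 - z)) / 2))
          holomorphic_on hyp_domain"
  proof (rule holomorphic_on_compose_gen[OF _ hypergeo_reg_continuation(1)])
    show "(\<lambda>z. (1 - csqrt (1 - z)) / 2) holomorphic_on hyp_domain"
      by (intro holomorphic_intros sqrt_hol) auto
    show "(\<lambda>z. (1 - csqrt (1 - z)) / 2) ` hyp_domain \<subseteq> hyp_domain"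
      using half by (auto simp: hyp_domain_def simp del: csqrt.simps)
  qed
  thus "(\<lambda>z. hypergeo_reg (b - a + 1 / 2) (a - b + 1 / 2) (a + b + 1 / 2) ((1 - csqrt (1 - z)) / 2))
          holomorphic_on hyp_domain" by (simp add: o_def)
  show "(\<lambda>z. ((1 + csqrt (1 - z)) / 2) powr (a + b - 1 / 2) * hypergeo_reg a b (a + b + 1 / 2) z)
          holomorphic_on hyp_domain"
  proof (intro holomorphic_intros sqrt_hol hypergeo_reg_continuation(1))
    show "(1 + csqrt (1 - z)) / 2 \<notin> \<real>\<^sub>\<le>\<^sub>0" if "z \<in> hyp_domain" for z
      using Re_csqrt_pos[OF hyp_domain_cut[OF that]]
      by (auto simp: complex_nonpos_Reals_iff simp del: csqrt.simps)
  qed (auto dest: hyp_domain_cut)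
  show "hypergeo_reg (b - a + 1 / 2) (a - b + 1 / 2) (a + b + 1 / 2) ((1 - csqrt (1 - z)) / 2) =
           ((1 + csqrt (1 - z)) / 2) powr (a + b - 1 / 2) * hypergeo_reg a b (a + b + 1 / 2) z"
    if "z \<in> ball 0 (1 / 100)" for z
  proof -
    have z: "norm z < 1 / 100" using that by simp
    have "z \<in> hyp_domain" using z by (auto simp: hyp_domain_def)
    hence "norm (1 - csqrt (1 - z)) \<le> norm z" by (rule norm_1_minus_csqrt_le)
    hence "norm ((1 - csqrt (1 - z)) / 2) < 1" using z by (simp add: norm_divide)
    thus ?thesis using quadratic_csqrt_near_0[OF z, of b a] z
      by (simp add: hypergeo_reg_continuation(2))
  qed
  show "ball 0 (1 / 100) \<subseteq> hyp_domain" by (auto simp: hyp_domain_def)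
qed (use assms in \<open>auto simp: open_hyp_domain connected_hyp_domain\<close>)

section \<open>The parameter-adding expansion\<close>

text \<open>
The expansion on which the theorem rests. In the \<open>N\<close>-th diagonal of the double series, the symbols of \<open>a\<close> and \<open>c\<close> no
longer depend on \<open>n\<close>, so that Vandermonde adds the parameters \<open>b\<close> and \<open>d\<close>. The absolute values are
dominated by the series with \<open>norm b + norm d\<close> in place of \<open>b + d\<close>, hence the
rearrangement is legitimate in the whole unit disc.
\<close>
lemma addition_series_disc:
  assumes w: "norm w < 1"
  shows "(\<lambda>n. pochhammer a n * pochhammer d n / fact n * w ^ n * hypergeo_reg b (a + of_nat n) (c + of_nat n) w)
           sums hypergeo_reg a (b + d) c w"
proof -
  define g where "g n j = pochhammer a n * pochhammer d n / fact n * w ^ n *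
      (hyp_coeff b (a + of_nat n) (c + of_nat n) j * w ^ j)" for n j
  have rows: "g n sums (pochhammer a n * pochhammer d n / fact n * w ^ n *
      hypergeo_reg b (a + of_nat n) (c + of_nat n) w)" for n
    unfolding g_def hypergeo_reg_continuation(2)[OF w]
    by (intro sums_mult hypergeo_reg_series_sums w)
  have g_diag: "g n (N - n) = pochhammer a N * rGamma (c + of_nat N) * w ^ N *
      (pochhammer d n * pochhammer b (N - n) / (fact n * fact (N - n)))" if "n \<le> N" for n N
  proof -
    have "w ^ N = w ^ n * w ^ (N - n)" using that by (simp flip: power_add)
    moreover have "pochhammer a N = pochhammer a n * pochhammer (a + of_nat n) (N - n)"
      by (rule pochhammer_product[OF that])
    moreover have "c + of_nat N = c + of_nat n + of_nat (N - n)" using that by (simp add: of_nat_diff)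
    ultimately show ?thesis by (simp add: g_def hyp_coeff_def add.assoc)
  qed
  have "(\<Sum>n\<le>N. g n (N - n)) = hyp_coeff a (b + d) c N * w ^ N" for N
  proof -
    have "(\<Sum>n\<le>N. g n (N - n)) = (\<Sum>n\<le>N. pochhammer a N * rGamma (c + of_nat N) * w ^ N *
        (pochhammer d n * pochhammer b (N - n) / (fact n * fact (N - n))))"
      by (rule sum.cong) (auto simp: g_diag)
    also have "\<dots> = hyp_coeff a (b + d) c N * w ^ N"
      unfolding sum_distrib_left[symmetric] vandermonde_fact by (simp add: hyp_coeff_def add.commute)
    finally show ?thesis .
  qed
  hence diag: "(\<lambda>N. \<Sum>n\<le>N. g n (N - n)) sums hypergeo_reg a (b + d) c w"
    using hypergeo_reg_series_sums[OF w, of a "b + d" c] by (simp add: hypergeo_reg_continuation(2)[OF w])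
  have bound: "(\<Sum>n\<le>N. norm (g n (N - n))) \<le> norm (hyp_coeff a (of_real (norm d + norm b)) c N * w ^ N)" for N
  proof -
    have "(\<Sum>n\<le>N. norm (g n (N - n))) \<le> (\<Sum>n\<le>N. norm (pochhammer a N * rGamma (c + of_nat N) * w ^ N) *
        (pochhammer (norm d) n * pochhammer (norm b) (N - n) / (fact n * fact (N - n))))"
    proof (rule sum_mono)
      fix n assume "n \<in> {..N}"
      hence n: "n \<le> N" by simp
      have "norm (pochhammer d n) * norm (pochhammer b (N - n)) \<le> pochhammer (norm d) n * pochhammer (norm b) (N - n)"
        by (intro mult_mono norm_pochhammer_le order_trans[OF norm_ge_zero norm_pochhammer_le] norm_ge_zero)
      thus "norm (g n (N - n)) \<le> norm (pochhammer a N * rGamma (c + of_nat N) * w ^ N) *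
        (pochhammer (norm d) n * pochhammer (norm b) (N - n) / (fact n * fact (N - n)))"
        unfolding g_diag[OF n] norm_mult[of "pochhammer a N * rGamma (c + of_nat N) * w ^ N"]
        by (intro mult_left_mono) (simp_all add: norm_mult norm_divide divide_right_mono)
    qed
    also have "\<dots> = norm (pochhammer a N * rGamma (c + of_nat N) * w ^ N) * (pochhammer (norm d + norm b) N / fact N)"
      unfolding sum_distrib_left[symmetric] vandermonde_fact ..
    also have "pochhammer (norm d + norm b) N = norm (pochhammer (of_real (norm d + norm b)) N :: complex)"
    proof -
      have "0 \<le> pochhammer (norm (of_real (norm d + norm b) :: complex)) N"
        by (rule order_trans[OF norm_ge_zero norm_pochhammer_le])
      moreover have "norm (of_real (norm d + norm b) :: complex) = norm d + norm b"
        by (simp only: norm_of_real abs_of_nonneg add_nonneg_nonneg norm_ge_zero)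
      ultimately show ?thesis by (simp only: pochhammer_of_real norm_of_real abs_of_nonneg)
    qed
    finally show ?thesis by (simp only: hyp_coeff_def norm_mult norm_divide norm_fact times_divide_eq_left times_divide_eq_right mult_ac)
  qed
  show ?thesis
    by (rule diagonal_sums[OF bound hyp_coeff_summable[OF w] diag rows])
qed

text \<open>
A finite sum is holomorphic wherever its terms are, so that the identity continues beyond the
disc.
\<close>
lemma addition_series_terminating:
  assumes zero: "\<And>n. n \<ge> K \<Longrightarrow> pochhammer a n * pochhammer d n = 0" and w: "w \<in> hyp_domain"
  shows "(\<lambda>n. pochhammer a n * pochhammer d n / fact n * w ^ n * hypergeo_reg b (a + of_nat n) (c + of_nat n) w)
           sums hypergeo_reg a (b + d) c w"
proof -
  define t where "t n w = pochhammer a n * pochhammer d n / fact n * w ^ n *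
      hypergeo_reg b (a + of_nat n) (c + of_nat n) w" for n w
  have fin: "(\<lambda>n. t n z) sums (\<Sum>n<K. t n z)" for z
    by (rule sums_finite) (use zero in \<open>auto simp: t_def not_less\<close>)
  have "(\<Sum>n<K. t n w) = hypergeo_reg a (b + d) c w"
  proof (rule analytic_continuation_open[where s = "ball 0 1" and s' = hyp_domain and z = w
        and f = "\<lambda>z. \<Sum>n<K. t n z"])
    show "(\<lambda>z. \<Sum>n<K. t n z) holomorphic_on hyp_domain"
      unfolding t_def by (intro holomorphic_intros hypergeo_reg_continuation(1))
    show "(\<Sum>n<K. t n z) = hypergeo_reg a (b + d) c z" if "z \<in> ball 0 1" for z
      using that fin[of z] addition_series_disc[of z a d b c] unfolding t_def
      by (intro sums_unique2[OF fin[unfolded t_def]]) simp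
    show "ball 0 1 \<subseteq> hyp_domain" by (auto simp: hyp_domain_def)
  qed (use w in \<open>auto simp: open_hyp_domain connected_hyp_domain hypergeo_reg_continuation(1)\<close>)
  with fin[of w] show ?thesis by (simp add: t_def)
qed

text \<open>
Raabe's test. Gauss's criterion for convergence at \<open>1\<close> has this form because the ratio of
consecutive coefficients is \<open>1 - (c + 1 - a - d) / n + \<dots>\<close> in first order. If the
coefficients are eventually zero, Raabe's test does not apply, and the series is finite; otherwise none of them
vanishes from some index on.
\<close>
lemma hyp_coeff_summable_at_1:
  assumes "Re (a + d - c) < 0"
  shows "summable (\<lambda>n. norm (hyp_coeff a d c n))"
proof (cases "\<exists>m. \<forall>n\<ge>m. hyp_coeff a d c n = 0")
  case True
  then obtain m where "\<And>n. n \<ge> m \<Longrightarrow> hyp_coeff a d c n = 0" by blast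
  thus ?thesis by (intro summable_finite[of "{..<m}"]) (auto simp: not_less)
next
  case False
  obtain M where M: "\<And>n. n \<ge> M \<Longrightarrow> c + of_nat n \<noteq> 0"
    using eventually_add_of_nat_nonzero[of c] by (auto simp: eventually_at_top_linorder)
  note Suc_ratio = hyp_coeff_Suc_ratio[OF M, of _ a d]
  have nz: "hyp_coeff a d c n \<noteq> 0" if n: "n \<ge> M" for n
  proof
    assume 0: "hyp_coeff a d c n = 0"
    have "hyp_coeff a d c m = 0" if "m \<ge> n" for m
      using that
    proof (induction m rule: dec_induct)
      case (step m)
      thus ?case using n by (simp add: Suc_ratio)
    qed (rule 0)
    with False show False by blast
  qed
  have nz': "a + of_nat n \<noteq> 0" "d + of_nat n \<noteq> 0" if "n \<ge> M" for n
    using nz[of "Suc n"] that by (auto simp: Suc_ratio)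
  \<comment> \<open>\<open>1 + z n\<close> is the ratio of the \<open>n\<close>-th coefficient to its successor; Raabe's quotient tends to \<open>Re L\<close>.\<close>
  define L where "L = c + 1 - a - d"
  define z where "z n = (c + of_nat n) / (a + of_nat n) * ((1 + of_nat n) / (d + of_nat n)) - 1" for n
  \<comment> \<open>\<open>of_nat n * z n\<close> is rewritten in ratios of the form \<open>(p + of_nat n) / (q + of_nat n)\<close>, which all tend to \<open>1\<close>.\<close>
  have "(\<lambda>n. (0 + of_nat n) / (a + of_nat n) * (L * ((0 + of_nat n) / (d + of_nat n)) +
           ((c - a * d + d + of_nat n) / (d + of_nat n) - 1))) \<longlonglongrightarrow> 1 * (L * 1 + (1 - 1))"
    by (intro tendsto_intros tendsto_shifted_ratio)
  moreover have "\<forall>\<^sub>F n in sequentially. (0 + of_nat n) / (a + of_nat n) * (L * ((0 + of_nat n) / (d + of_nat n)) +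
           ((c - a * d + d + of_nat n) / (d + of_nat n) - 1)) = of_nat n * z n"
    using eventually_ge_at_top[of M]
  proof eventually_elim
    case (elim n)
    have "(0 + k) / A * (L * ((0 + k) / D) + ((c - a * d + d + k) / D - 1)) = k * ((c + k) / A * ((1 + k) / D) - 1)"
      if "A \<noteq> 0" "D \<noteq> 0" "A = a + k" "D = d + k" for A D k
      using that(1,2) by (simp add: field_simps) (simp add: that(3,4) L_def algebra_simps)
    from this[OF nz'[OF elim]] show ?case by (simp add: z_def)
  qed
  ultimately have nzn: "(\<lambda>n. of_nat n * z n) \<longlonglongrightarrow> L" by (simp add: Lim_transform_eventually)
  have "z \<longlonglongrightarrow> 1 * 1 - 1" unfolding z_def by (intro tendsto_intros tendsto_shifted_ratio)
  hence z0: "z \<longlonglongrightarrow> 0" by simp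
  define f where "f n = norm (hyp_coeff a d c n)" for n
  \<comment> \<open>Rationalizing \<open>norm (1 + w) - 1\<close> shows that its first-order part is \<open>Re w\<close>.\<close>
  have norm_expand: "norm (1 + w) - 1 = (2 * Re w + (norm w)\<^sup>2) / (norm (1 + w) + 1)" for w
  proof -
    have "(norm (1 + w))\<^sup>2 - 1 = 2 * Re w + (norm w)\<^sup>2"
      unfolding cmod_power2 by (simp add: power2_eq_square algebra_simps)
    moreover have "norm (1 + w) + 1 > 0" by (simp add: add_nonneg_pos)
    ultimately show ?thesis by (simp add: field_simps power2_eq_square)
  qed
  have "(\<lambda>n. (2 * Re (of_nat n * z n) + norm (of_nat n * z n) * norm (z n)) / (norm (1 + z n) + 1))
     \<longlonglongrightarrow> (2 * Re L + norm L * norm (0 :: complex)) / (norm (1 + 0 :: complex) + 1)"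
    by (intro tendsto_intros nzn z0) simp
  moreover have "\<forall>\<^sub>F n in sequentially. (2 * Re (of_nat n * z n) + norm (of_nat n * z n) * norm (z n)) / (norm (1 + z n) + 1)
      = of_nat n * (f n / f (Suc n) - 1)"
    using eventually_ge_at_top[of M]
  proof eventually_elim
    case (elim n)
    have "f n / f (Suc n) = norm (1 + z n)"
      unfolding f_def Suc_ratio[OF elim] using nz[OF elim] nz'[OF elim] M[OF elim]
      by (simp add: z_def norm_divide norm_mult)
    hence "of_nat n * (f n / f (Suc n) - 1) = of_nat n * ((2 * Re (z n) + (norm (z n))\<^sup>2) / (norm (1 + z n) + 1))"
      by (simp only: norm_expand)
    thus ?case by (simp add: norm_mult power2_eq_square algebra_simps)
  qed
  ultimately have "(\<lambda>n. of_nat n * (f n / f (Suc n) - 1)) \<longlonglongrightarrow> Re L"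
    by (simp add: Lim_transform_eventually)
  hence "(\<lambda>n. ereal (of_nat n * (f n / f (Suc n) - 1))) \<longlonglongrightarrow> ereal (Re L)" by simp
  hence "liminf (\<lambda>n. ereal (of_nat n * (f n / f (Suc n) - 1))) = ereal (Re L)"
    by (rule lim_imp_Liminf[rotated]) simp
  moreover have "Re L > 1" using assms by (simp add: L_def)
  moreover have "\<forall>\<^sub>F n in sequentially. f n > 0"
    using eventually_ge_at_top[of M] by eventually_elim (use nz in \<open>simp add: f_def\<close>)
  ultimately have "summable f" by (intro raabes_test_convergence) auto
  thus ?thesis by (simp add: f_def[abs_def])
qed

lemma fact_le_norm_pochhammer:
  assumes "Re z \<ge> 1"
  shows "fact k \<le> norm (pochhammer z k)"
proof (induction k)
  case (Suc k)
  have "1 + real k \<le> norm (z + of_nat k)"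
    using assms complex_Re_le_cmod[of "z + of_nat k"] by simp
  with Suc.IH have "fact k * (1 + real k) \<le> norm (pochhammer z k) * norm (z + of_nat k)"
    by (intro mult_mono) auto
  moreover have "fact (Suc k) = fact k * (1 + real k)" by (simp add: algebra_simps)
  ultimately show ?case by (simp only: pochhammer_Suc norm_mult)
qed simp

text \<open>
Uniformity in \<open>c\<close> is what matters here: it bounds all the functions with shifted parameters
\<open>c + of_nat n\<close> at once, up to the factor \<open>rGamma (c + of_nat n)\<close>.
\<close>
lemma hypergeo_reg_series_uniform_bound:
  obtains K where "\<And>c v. Re c \<ge> 1 \<Longrightarrow> norm v \<le> 1 / 2 \<Longrightarrow> norm (hypergeo_reg_series a b c v) \<le> norm (rGamma c) * K"
proof -
  define h where "h k = norm (hyp_coeff a b 1 k * (1 / 2) ^ k)" for k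
  have h: "summable h" unfolding h_def by (rule hyp_coeff_summable) simp
  have "norm (hypergeo_reg_series a b c v) \<le> norm (rGamma c) * suminf h"
    if c: "Re c \<ge> 1" and v: "norm v \<le> 1 / 2" for c v
  proof -
    have summand: "norm (hyp_coeff a b c k * v ^ k) \<le> norm (rGamma c) * h k" for k
    proof -
      have "norm (rGamma (c + of_nat k)) * fact k \<le> norm (rGamma (c + of_nat k)) * norm (pochhammer c k)"
        by (intro mult_left_mono fact_le_norm_pochhammer c) simp
      also have "\<dots> = norm (rGamma c)" by (simp add: pochhammer_rGamma[of c k] norm_mult)
      finally have 1: "norm (rGamma (c + of_nat k)) \<le> norm (rGamma c) * (1 / fact k)"
        by (simp add: field_simps)
      have "norm (hyp_coeff a b c k * v ^ k) =
          norm (pochhammer a k * pochhammer b k / fact k) * (norm (rGamma (c + of_nat k)) * norm v ^ k)"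
        by (simp add: hyp_coeff_def norm_mult norm_divide norm_power)
      also have "\<dots> \<le> norm (pochhammer a k * pochhammer b k / fact k) * (norm (rGamma c) * (1 / fact k) * (1 / 2) ^ k)"
        by (intro mult_left_mono mult_mono 1 power_mono v) auto
      also have "\<dots> = norm (rGamma c) * h k"
        by (simp add: h_def hyp_coeff_def norm_mult norm_divide norm_power rGamma_inverse_Gamma Gamma_fact norm_inverse field_simps)
      finally show ?thesis .
    qed
    have "norm v < 1" using v by simp
    hence "norm (hypergeo_reg_series a b c v) = norm (\<Sum>k. hyp_coeff a b c k * v ^ k)"
      by (simp add: sums_unique[OF hypergeo_reg_series_sums])
    also have "\<dots> \<le> (\<Sum>k. norm (hyp_coeff a b c k * v ^ k))"
      by (intro summable_norm hyp_coeff_summable \<open>norm v < 1\<close>)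
    also have "\<dots> \<le> (\<Sum>k. norm (rGamma c) * h k)"
      by (intro suminf_le summand hyp_coeff_summable \<open>norm v < 1\<close> summable_mult h)
    also have "\<dots> = norm (rGamma c) * suminf h" by (rule suminf_mult[OF h])
    finally show ?thesis .
  qed
  thus ?thesis by (rule that)
qed

text \<open>
An Abel-type argument. After Pfaff's transformation the variable lies in \<open>{0..1/2}\<close> for \<open>x \<in> {-1..0}\<close>, and the first two parameters no
longer depend on \<open>n\<close>; so, up to a constant, the terms are dominated on the closed interval by the coefficients \<open>hyp_coeff a d c n\<close>, whose
sum converges absolutely by assumption. The series is then continuous up to \<open>-1\<close>, and so is the right-hand
side.
\<close>
lemma addition_series_minus_1:
  assumes "Re (a + d - c) < 0"
  shows "(\<lambda>n. pochhammer a n * pochhammer d n / fact n * (- 1) ^ n * hypergeo_reg b (a + of_nat n) (c + of_nat n) (- 1))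
           sums hypergeo_reg a (b + d) c (- 1)"
proof -
  define t where "t n x = pochhammer a n * pochhammer d n / fact n * of_real x ^ n *
      hypergeo_reg b (a + of_nat n) (c + of_nat n) (of_real x)" for n and x :: real
  define H where "H x = hypergeo_reg a (b + d) c (of_real x)" for x :: real
  let ?I = "{- 1..0 :: real}"
  obtain K where K: "\<And>c' v. Re c' \<ge> 1 \<Longrightarrow> norm v \<le> 1 / 2 \<Longrightarrow>
      norm (hypergeo_reg_series b (c - a) c' v) \<le> norm (rGamma c') * K"
    using hypergeo_reg_series_uniform_bound by blast
  define M where "M n = norm (hyp_coeff a d c n) * (2 powr \<bar>Re b\<bar> * K)" for n
  have summable_M: "summable M"
    unfolding M_def by (intro summable_mult2 hyp_coeff_summable_at_1 assms)
  obtain n0 :: nat where n0: "1 - Re c \<le> real n0" using real_arch_simple by blast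
  have le_M: "norm (t n x) \<le> M n" if n: "n \<ge> n0" and x: "x \<in> ?I" for n x
  proof -
    define w where "w = complex_of_real x"
    have "Re (c + of_nat n) \<ge> 1" using n n0 by simp
    moreover have "norm (w / (w - 1)) \<le> 1 / 2"
    proof -
      have "w / (w - 1) = of_real (x / (x - 1))" by (simp add: w_def)
      moreover have "\<bar>x / (x - 1)\<bar> \<le> 1 / 2" using x by (simp add: abs_le_iff field_simps)
      ultimately show ?thesis by (simp only: norm_of_real)
    qed
    ultimately have S: "norm (hypergeo_reg_series b (c - a) (c + of_nat n) (w / (w - 1))) \<le> norm (rGamma (c + of_nat n)) * K"
      by (rule K)
    have "1 - w = of_real (1 - x)" by (simp add: w_def)
    hence "norm ((1 - w) powr (- b)) = (1 - x) powr (- Re b)"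
      using x norm_powr_real_powr[of "of_real (1 - x)" "- b"] by simp
    also have "\<dots> \<le> (1 - x) powr \<bar>Re b\<bar>" using x by (intro powr_mono) auto
    also have "\<dots> \<le> 2 powr \<bar>Re b\<bar>" using x by (intro powr_mono2) auto
    finally have P: "norm ((1 - w) powr (- b)) \<le> 2 powr \<bar>Re b\<bar>" .
    have "c + of_nat n - (a + of_nat n) = c - a" by simp
    hence "hypergeo_reg b (a + of_nat n) (c + of_nat n) w =
        (1 - w) powr (- b) * hypergeo_reg_series b (c - a) (c + of_nat n) (w / (w - 1))"
      using x hypergeo_reg_continuation(3)[of w b "a + of_nat n" "c + of_nat n"] by (simp add: w_def)
    hence "norm (hypergeo_reg b (a + of_nat n) (c + of_nat n) w) \<le> 2 powr \<bar>Re b\<bar> * (norm (rGamma (c + of_nat n)) * K)"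
      using P S by (simp add: norm_mult mult_mono')
    moreover have "norm (w ^ n) \<le> 1" using x by (simp add: w_def norm_power power_le_one)
    ultimately have "norm (w ^ n) * norm (hypergeo_reg b (a + of_nat n) (c + of_nat n) w) \<le>
        1 * (2 powr \<bar>Re b\<bar> * (norm (rGamma (c + of_nat n)) * K))"
      by (intro mult_mono) auto
    hence "norm (pochhammer a n * pochhammer d n / fact n) * (norm (w ^ n) * norm (hypergeo_reg b (a + of_nat n) (c + of_nat n) w)) \<le>
       norm (pochhammer a n * pochhammer d n / fact n) * (1 * (2 powr \<bar>Re b\<bar> * (norm (rGamma (c + of_nat n)) * K)))"
      by (rule mult_left_mono) simp
    thus ?thesis by (simp add: t_def M_def w_def hyp_coeff_def norm_mult norm_divide mult_ac)
  qed
  have ev: "\<forall>\<^sub>F n in sequentially. \<forall>x\<in>?I. norm (t n x) \<le> M n"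
    using eventually_ge_at_top[of n0] by eventually_elim (use le_M in blast)
  have cont_H: "continuous_on ?I (\<lambda>x. hypergeo_reg p q r (complex_of_real x))" for p q r
  proof (rule continuous_on_compose2[where g = "hypergeo_reg p q r" and t = hyp_domain])
    show "continuous_on hyp_domain (hypergeo_reg p q r)"
      by (intro holomorphic_on_imp_continuous_on hypergeo_reg_continuation(1))
  qed (auto simp: hyp_domain_def intro!: continuous_intros)
  have "uniform_limit ?I (\<lambda>n x. \<Sum>i<n. t i x) (\<lambda>x. \<Sum>i. t i x) sequentially"
    by (rule Weierstrass_m_test_ev[OF ev summable_M])
  moreover have "\<forall>\<^sub>F n in sequentially. continuous_on ?I (\<lambda>x. \<Sum>i<n. t i x)"
    unfolding t_def by (intro always_eventually allI continuous_intros cont_H)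
  ultimately have "continuous_on ?I (\<lambda>x. \<Sum>i. t i x)"
    by (intro uniform_limit_theorem) auto
  hence "continuous_on (closure {- 1<..<0}) (\<lambda>x. (\<Sum>i. t i x) - H x)"
    unfolding H_def by (simp add: continuous_on_diff cont_H)
  moreover have "(\<Sum>i. t i x) - H x = 0" if "x \<in> {- 1<..<0}" for x
    using addition_series_disc[of "of_real x" a d b c] that
    by (simp add: t_def H_def sums_iff)
  moreover have "(- 1 :: real) \<in> closure {- 1<..<0}" by simp
  ultimately have "(\<Sum>i. t i (- 1)) - H (- 1) = 0" by (rule continuous_constant_on_closure)
  moreover have "summable (\<lambda>i. t i (- 1))"
    using eventually_mono[OF ev] by (intro summable_comparison_test_ev[OF _ summable_M]) auto
  ultimately have "(\<lambda>i. t i (- 1)) sums H (- 1)" by (simp add: sums_iff)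
  thus ?thesis by (simp add: t_def H_def)
qed

section \<open>Legendre functions\<close>

lemma of_real_powr_eq_exp:
  "r > 0 \<Longrightarrow> complex_of_real r powr s = exp (s * of_real (ln r))"
  by (simp add: powr_def Ln_of_real)

lemma of_real_1_minus_in_hyp_domain:
  assumes "x > 0"
  shows "complex_of_real (1 - x\<^sup>2) \<in> hyp_domain"
proof (cases "x\<^sup>2 > 1 / 2")
  case False
  moreover have "x\<^sup>2 > 0" using assms by simp
  ultimately have "norm (complex_of_real (1 - x\<^sup>2)) < 1" by (simp only: norm_of_real abs_less_iff) simp
  thus ?thesis by (simp add: hyp_domain_def del: of_real_diff)
qed (simp add: hyp_domain_def)

text \<open>
In this form the argument is \<open>1 - x\<^sup>2\<close> on both sides of \<open>x = 1\<close>, and a simultaneous shift of degree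
and order shifts the first and third parameters and leaves the second one fixed.
\<close>
lemma legendre_P_quadratic:
  assumes "x > 0" "x \<noteq> 1"
  shows "legendre_P \<nu> (- \<mu>) x = 2 powr (- \<mu>) * of_real \<bar>1 - x\<^sup>2\<bar> powr (\<mu> / 2) *
           hypergeo_reg ((\<mu> + \<nu> + 1) / 2) ((\<mu> - \<nu>) / 2) (1 + \<mu>) (of_real (1 - x\<^sup>2))"
proof -
  define a where "a = (\<mu> + \<nu> + 1) / 2"
  define b where "b = (\<mu> - \<nu>) / 2"
  have params: "b - a + 1 / 2 = - \<nu>" "a - b + 1 / 2 = \<nu> + 1" "a + b + 1 / 2 = 1 + \<mu>" "a + b - 1 / 2 = \<mu>"
    by (simp_all add: a_def b_def field_simps)
  have "csqrt (1 - complex_of_real (1 - x\<^sup>2)) = of_real (sqrt (x\<^sup>2))"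
    by (subst of_real_sqrt) simp_all
  hence root: "csqrt (1 - complex_of_real (1 - x\<^sup>2)) = of_real x" using assms by simp
  have "legendre_P \<nu> (- \<mu>) x = of_real \<bar>(1 - x) / (1 + x)\<bar> powr (\<mu> / 2) *
      hypergeo_reg (- \<nu>) (\<nu> + 1) (1 + \<mu>) ((1 - of_real x) / 2)"
    by (simp add: legendre_P_def)
  also have "\<dots> = of_real \<bar>(1 - x) / (1 + x)\<bar> powr (\<mu> / 2) * ((1 + of_real x) / 2) powr \<mu> *
      hypergeo_reg a b (1 + \<mu>) (of_real (1 - x\<^sup>2))"
    using quadratic_transformation[OF of_real_1_minus_in_hyp_domain[OF assms(1)], of b a]
    unfolding params root by simp
  also have "of_real \<bar>(1 - x) / (1 + x)\<bar> powr (\<mu> / 2) * ((1 + of_real x) / 2) powr \<mu> =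
      2 powr (- \<mu>) * of_real \<bar>1 - x\<^sup>2\<bar> powr (\<mu> / 2)"
  proof -
    define p where "p = ln \<bar>1 - x\<bar>"
    define q where "q = ln (1 + x)"
    have pos: "\<bar>1 - x\<bar> > 0" "1 + x > 0" using assms by auto
    have 1: "ln \<bar>(1 - x) / (1 + x)\<bar> = p - q"
      using pos by (simp add: p_def q_def abs_divide ln_div)
    have "\<bar>1 - x\<^sup>2\<bar> = \<bar>1 - x\<bar> * (1 + x)"
    proof -
      have "1 - x\<^sup>2 = (1 - x) * (1 + x)" by (simp add: power2_eq_square algebra_simps)
      thus ?thesis using pos by (simp only: abs_mult abs_of_pos)
    qed
    hence 2: "ln \<bar>1 - x\<^sup>2\<bar> = p + q" "\<bar>1 - x\<^sup>2\<bar> > 0"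
      using pos by (simp_all add: p_def q_def ln_mult)
    have 3: "ln ((1 + x) / 2) = q - ln 2" using pos by (simp add: q_def ln_div)
    have "of_real \<bar>(1 - x) / (1 + x)\<bar> powr (\<mu> / 2) = exp (\<mu> / 2 * of_real (p - q))"
      using pos of_real_powr_eq_exp[of "\<bar>(1 - x) / (1 + x)\<bar>" "\<mu> / 2"] unfolding 1 by simp
    moreover have "((1 + of_real x) / 2) powr \<mu> = exp (\<mu> * of_real (q - ln 2))"
      using pos of_real_powr_eq_exp[of "(1 + x) / 2" \<mu>] by (simp add: 3)
    moreover have "2 powr (- \<mu>) = exp (- \<mu> * of_real (ln 2))"
      using of_real_powr_eq_exp[of 2 "- \<mu>"] by simp
    moreover have "of_real \<bar>1 - x\<^sup>2\<bar> powr (\<mu> / 2) = exp (\<mu> / 2 * of_real (p + q))"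
      using 2 by (simp only: of_real_powr_eq_exp)
    ultimately show ?thesis
      by (simp only: exp_add[symmetric]) (simp add: algebra_simps add_divide_distrib[symmetric] diff_divide_distrib)
  qed
  finally show ?thesis by (simp only: a_def b_def)
qed

text \<open>
The arguments \<open>1 - x\<^sup>2\<close> and \<open>1 - 1 / x\<^sup>2\<close> correspond under \<open>w \<mapsto> w / (w - 1)\<close>. This is why the value of one
of the two series involves the other Legendre function.
\<close>
lemma pfaff_inverse_square:
  assumes "0 < x" "x < 1"
  shows "hypergeo_reg p q r (of_real (1 - 1 / x\<^sup>2)) = of_real x powr (2 * p) * hypergeo_reg p (r - q) r (of_real (1 - x\<^sup>2))"
proof -
  define w where "w = complex_of_real (1 - 1 / x\<^sup>2)"
  have x2: "0 < x\<^sup>2" "x\<^sup>2 < 1" using assms by (simp_all add: power_less_one_iff)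
  have "hypergeo_reg p q r w = (1 - w) powr (- p) * hypergeo_reg_series p (r - q) r (w / (w - 1))"
    using x2 by (intro hypergeo_reg_continuation(3)) (simp add: w_def field_simps)
  also have "w / (w - 1) = of_real (1 - x\<^sup>2)"
    using x2 by (simp add: w_def field_simps)
  also have "hypergeo_reg_series p (r - q) r (of_real (1 - x\<^sup>2)) = hypergeo_reg p (r - q) r (of_real (1 - x\<^sup>2))"
    using x2 by (intro hypergeo_reg_continuation(2)[symmetric]) (simp only: norm_of_real abs_less_iff, simp)
  also have "(1 - w) powr (- p) = of_real x powr (2 * p)"
  proof -
    have "1 - w = of_real (1 / x\<^sup>2)" by (simp add: w_def)
    moreover have "ln (1 / x\<^sup>2) = - 2 * ln x" using assms by (simp add: ln_div ln_realpow)
    ultimately show ?thesis using assms x2 of_real_powr_eq_exp[of "1 / x\<^sup>2" "- p"] of_real_powr_eq_exp[of x "2 * p"]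
      by (simp add: mult_ac)
  qed
  finally show ?thesis by (simp only: w_def)
qed

text \<open>
The Legendre function contributes \<open>2 powi (- int n)\<close>, which cancels, and a factor \<open>Q = (1 - x\<^sup>2) powr (n / 2)\<close>;
together with the explicit \<open>Q\<close> this makes the \<open>n\<close>-th power of the argument that \<open>addition_series_disc\<close> requires.
\<close>
lemma direct_term_eq:
  assumes "0 < x" "x < 1"
  shows "pochhammer ((\<mu> + \<nu> + 1) / 2) n * pochhammer (\<nu> + 1) n
           / (2 powi (- int n) * fact n * complex_of_real (1 - x\<^sup>2) powr (- of_nat n / 2))
           * legendre_P (\<nu> + of_nat n) (- \<mu> - of_nat n) x =
         2 powr (- \<mu>) * of_real (1 - x\<^sup>2) powr (\<mu> / 2) *
         (pochhammer ((\<mu> + \<nu> + 1) / 2) n * pochhammer (\<nu> + 1) n / fact n * of_real (1 - x\<^sup>2) ^ n *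
          hypergeo_reg ((\<mu> - \<nu>) / 2) ((\<mu> + \<nu> + 1) / 2 + of_nat n) (1 + \<mu> + of_nat n) (of_real (1 - x\<^sup>2)))"
proof -
  define y where "y = 1 - x\<^sup>2"
  have y: "y > 0" using assms by (simp add: y_def power_less_one_iff)
  define Q where "Q = complex_of_real y powr (of_nat n / 2)"
  have QQ: "Q * Q = of_real y ^ n" using y by (simp add: Q_def powr_nat' flip: powr_add)
  have "Q \<noteq> 0" using y by (simp add: Q_def)
  have Q_inv: "complex_of_real y powr (- of_nat n / 2) = inverse Q" by (simp add: Q_def powr_minus)
  have "legendre_P (\<nu> + of_nat n) (- \<mu> - of_nat n) x = legendre_P (\<nu> + of_nat n) (- (\<mu> + of_nat n)) x" by simp
  also have "\<dots> = 2 powr (- (\<mu> + of_nat n)) * of_real \<bar>1 - x\<^sup>2\<bar> powr ((\<mu> + of_nat n) / 2) *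
           hypergeo_reg ((\<mu> + of_nat n + (\<nu> + of_nat n) + 1) / 2) ((\<mu> + of_nat n - (\<nu> + of_nat n)) / 2) (1 + (\<mu> + of_nat n)) (of_real (1 - x\<^sup>2))"
    using assms by (intro legendre_P_quadratic) auto
  also have "(\<mu> + of_nat n + (\<nu> + of_nat n) + 1) / 2 = (\<mu> + \<nu> + 1) / 2 + of_nat n" by (simp add: field_simps)
  also have "(\<mu> + of_nat n - (\<nu> + of_nat n)) / 2 = (\<mu> - \<nu>) / 2" by simp
  also have "1 + (\<mu> + of_nat n) = 1 + \<mu> + of_nat n" by simp
  also have "\<bar>1 - x\<^sup>2\<bar> = y" using y by (simp add: y_def)
  also have "of_real y powr ((\<mu> + of_nat n) / 2) = of_real y powr (\<mu> / 2) * Q"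
    by (simp add: Q_def add_divide_distrib powr_add)
  also have "2 powr (- (\<mu> + of_nat n)) = 2 powr (- \<mu>) / (2 :: complex) ^ n" by (rule powr_minus_add_nat) simp
  finally have L: "legendre_P (\<nu> + of_nat n) (- \<mu> - of_nat n) x = 2 powr (- \<mu>) / 2 ^ n * (of_real y powr (\<mu> / 2) * Q) *
      hypergeo_reg ((\<mu> - \<nu>) / 2) ((\<mu> + \<nu> + 1) / 2 + of_nat n) (1 + \<mu> + of_nat n) (of_real (1 - x\<^sup>2))"
    by (subst hypergeo_reg_commute[of "(\<mu> - \<nu>) / 2"])
  show ?thesis
    unfolding L y_def[symmetric] Q_inv QQ[symmetric] using \<open>Q \<noteq> 0\<close>
    by (simp add: power_int_minus field_simps)
qed

text \<open>
The substitution of \<open>1 / x\<close> turns the argument \<open>1 - x\<^sup>2\<close> into \<open>1 - 1 / x\<^sup>2\<close>.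
\<close>
lemma legendre_P_reciprocal:
  assumes "0 < x" "x < 1"
  shows "legendre_P \<nu> (- \<mu>) (1 / x) = 2 powr (- \<mu>) * of_real (1 - x\<^sup>2) powr (\<mu> / 2) * of_real x powr (- \<mu>) *
      hypergeo_reg ((\<mu> + \<nu> + 1) / 2) ((\<mu> - \<nu>) / 2) (1 + \<mu>) (of_real (1 - 1 / x\<^sup>2))"
proof -
  have x2: "0 < x\<^sup>2" "x\<^sup>2 < 1" using assms by (simp_all add: power_less_one_iff)
  have abs: "\<bar>1 - (1 / x)\<^sup>2\<bar> = (1 - x\<^sup>2) / x\<^sup>2" using x2 by (simp add: power_divide field_simps)
  have "ln ((1 - x\<^sup>2) / x\<^sup>2) = ln (1 - x\<^sup>2) - 2 * ln x"
    using assms x2 by (simp add: ln_div ln_realpow)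
  hence "of_real ((1 - x\<^sup>2) / x\<^sup>2) powr (\<mu> / 2) = of_real (1 - x\<^sup>2) powr (\<mu> / 2) * complex_of_real x powr (- \<mu>)"
    using assms x2 of_real_powr_eq_exp[of "(1 - x\<^sup>2) / x\<^sup>2" "\<mu> / 2"] of_real_powr_eq_exp[of x "- \<mu>"] of_real_powr_eq_exp[of "1 - x\<^sup>2" "\<mu> / 2"]
    by (simp only: exp_add[symmetric] divide_pos_pos diff_gt_0_iff_gt) (simp add: algebra_simps)
  moreover have "legendre_P \<nu> (- \<mu>) (1 / x) = 2 powr (- \<mu>) * of_real \<bar>1 - (1 / x)\<^sup>2\<bar> powr (\<mu> / 2) *
      hypergeo_reg ((\<mu> + \<nu> + 1) / 2) ((\<mu> - \<nu>) / 2) (1 + \<mu>) (of_real (1 - (1 / x)\<^sup>2))"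
    using assms by (intro legendre_P_quadratic) auto
  ultimately show ?thesis unfolding abs by (simp add: power_divide mult_ac)
qed

text \<open>
The same for the argument \<open>1 - 1 / x\<^sup>2\<close>. It is negative, and its powers absorb the sign in \<open>- 2\<close>; the
additional powers of \<open>x\<close> come from the prefactor of the Legendre function.
\<close>
lemma reciprocal_term_eq:
  assumes "0 < x" "x < 1"
  shows "pochhammer ((\<mu> + \<nu> + 1) / 2) n * pochhammer (\<nu> + 1) n
           / ((- 2) powi (- int n) * fact n * complex_of_real (1 - x\<^sup>2) powr (- of_nat n / 2)
              * complex_of_real x powr (\<nu> + of_nat n + 1))
           * legendre_P (\<nu> + of_nat n) (- \<mu> - of_nat n) (1 / x) =
         2 powr (- \<mu>) * of_real (1 - x\<^sup>2) powr (\<mu> / 2) * of_real x powr (- (\<mu> + \<nu> + 1)) *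
         (pochhammer ((\<mu> + \<nu> + 1) / 2) n * pochhammer (\<nu> + 1) n / fact n * of_real (1 - 1 / x\<^sup>2) ^ n *
          hypergeo_reg ((\<mu> - \<nu>) / 2) ((\<mu> + \<nu> + 1) / 2 + of_nat n) (1 + \<mu> + of_nat n) (of_real (1 - 1 / x\<^sup>2)))"
proof -
  define y where "y = 1 - x\<^sup>2"
  have y: "y > 0" using assms by (simp add: y_def power_less_one_iff)
  define Q where "Q = complex_of_real y powr (of_nat n / 2)"
  define X where "X = complex_of_real x powr (\<nu> + 1)"
  have QQ: "Q * Q = of_real y ^ n" using y by (simp add: Q_def powr_nat' flip: powr_add)
  have nz: "Q \<noteq> 0" "X \<noteq> 0" using y assms by (simp_all add: Q_def X_def)
  have Q_inv: "complex_of_real y powr (- of_nat n / 2) = inverse Q" by (simp add: Q_def powr_minus)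
  have X1: "complex_of_real x powr (\<nu> + of_nat n + 1) = X * of_real x ^ n"
    using assms powr_add[of "complex_of_real x" "\<nu> + 1" "of_nat n"] by (simp add: X_def powr_nat' add_ac)
  have X2: "complex_of_real x powr (- (\<mu> + \<nu> + 1)) = of_real x powr (- \<mu>) / X"
  proof -
    have "- (\<mu> + \<nu> + 1) = - \<mu> - (\<nu> + 1)" by simp
    thus ?thesis by (simp only: powr_diff X_def)
  qed
  have "1 - 1 / x\<^sup>2 = - (y / x\<^sup>2)" using assms by (simp add: y_def field_simps)
  hence "complex_of_real (1 - 1 / x\<^sup>2) ^ n = (- (of_real y / (of_real x)\<^sup>2)) ^ n" by (simp only: of_real_minus of_real_divide of_real_power)
  also have "\<dots> = (- 1) ^ n * (of_real y ^ n / (of_real x ^ n * of_real x ^ n))"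
    by (subst power_minus) (simp add: power_divide power_mult_distrib power2_eq_square)
  finally have W: "complex_of_real (1 - 1 / x\<^sup>2) ^ n = (- 1) ^ n * (Q * Q / (of_real x ^ n * of_real x ^ n))"
    by (simp only: QQ)
  have "legendre_P (\<nu> + of_nat n) (- \<mu> - of_nat n) (1 / x) = legendre_P (\<nu> + of_nat n) (- (\<mu> + of_nat n)) (1 / x)" by simp
  also have "\<dots> = 2 powr (- (\<mu> + of_nat n)) * of_real (1 - x\<^sup>2) powr ((\<mu> + of_nat n) / 2) * of_real x powr (- (\<mu> + of_nat n)) *
           hypergeo_reg ((\<mu> + of_nat n + (\<nu> + of_nat n) + 1) / 2) ((\<mu> + of_nat n - (\<nu> + of_nat n)) / 2) (1 + (\<mu> + of_nat n)) (of_real (1 - 1 / x\<^sup>2))"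
    by (rule legendre_P_reciprocal[OF assms])
  also have "(\<mu> + of_nat n + (\<nu> + of_nat n) + 1) / 2 = (\<mu> + \<nu> + 1) / 2 + of_nat n" by (simp add: field_simps)
  also have "(\<mu> + of_nat n - (\<nu> + of_nat n)) / 2 = (\<mu> - \<nu>) / 2" by simp
  also have "1 + (\<mu> + of_nat n) = 1 + \<mu> + of_nat n" by simp
  also have "of_real (1 - x\<^sup>2) powr ((\<mu> + of_nat n) / 2) = of_real y powr (\<mu> / 2) * Q"
    by (simp add: Q_def add_divide_distrib powr_add y_def)
  also have "2 powr (- (\<mu> + of_nat n)) = 2 powr (- \<mu>) / (2 :: complex) ^ n" by (rule powr_minus_add_nat) simp
  also have "of_real x powr (- (\<mu> + of_nat n)) = of_real x powr (- \<mu>) / complex_of_real x ^ n"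
    using assms by (intro powr_minus_add_nat) simp
  finally have L: "legendre_P (\<nu> + of_nat n) (- \<mu> - of_nat n) (1 / x) =
      2 powr (- \<mu>) / 2 ^ n * (of_real y powr (\<mu> / 2) * Q) * (of_real x powr (- \<mu>) / of_real x ^ n) *
      hypergeo_reg ((\<mu> - \<nu>) / 2) ((\<mu> + \<nu> + 1) / 2 + of_nat n) (1 + \<mu> + of_nat n) (of_real (1 - 1 / x\<^sup>2))"
    by (subst hypergeo_reg_commute[of "(\<mu> - \<nu>) / 2"])
  have sgn: "(- 2 :: complex) powi (- int n) = inverse ((- 1) ^ n * 2 ^ n)"
    by (simp add: power_int_minus flip: power_mult_distrib)
  have "((- 1) ^ n :: complex) * (- 1) ^ n = 1" by (simp flip: power_mult_distrib)
  hence sgn': "inverse ((- 1) ^ n :: complex) = (- 1) ^ n" by (intro inverse_unique)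
  show ?thesis
    unfolding L y_def[symmetric] Q_inv X1 X2 W sgn inverse_mult_distrib sgn' using nz
    by (simp add: divide_simps)
qed


theorem theorem5:
  fixes \<mu> \<nu> :: complex
  shows "(\<forall>x::real.
            (2 powr (- 1 / 2) < x \<and> x < 1)
          \<or> (x = 2 powr (- 1 / 2) \<and> Re (3 * \<nu> - \<mu>) < - 1)
          \<or> (0 < x \<and> x < 1 \<and>
               ((\<exists>k::nat. k \<ge> 1 \<and> - \<nu> = of_nat k) \<or>
                (\<exists>k::nat. - ((\<mu> + \<nu> + 1) / 2) = of_nat k)))
          \<longrightarrow> (\<lambda>n::nat.
                 pochhammer ((\<mu> + \<nu> + 1) / 2) n * pochhammer (\<nu> + 1) n
                 / ((- 2) powi (- int n) * fact n
                    * complex_of_real (1 - x\<^sup>2) powr (- of_nat n / 2)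
                    * complex_of_real x powr (\<nu> + of_nat n + 1))
                 * legendre_P (\<nu> + of_nat n) (- \<mu> - of_nat n) (1 / x))
              sums legendre_P \<nu> (- \<mu>) x)
       \<and> (\<forall>x::real. 0 < x \<and> x < 1
          \<longrightarrow> (\<lambda>n::nat.
                 pochhammer ((\<mu> + \<nu> + 1) / 2) n * pochhammer (\<nu> + 1) n
                 / (2 powi (- int n) * fact n
                    * complex_of_real (1 - x\<^sup>2) powr (- of_nat n / 2))
                 * legendre_P (\<nu> + of_nat n) (- \<mu> - of_nat n) x)
              sums (legendre_P \<nu> (- \<mu>) (1 / x) / complex_of_real x powr (\<nu> + 1)))"
proof (intro conjI allI impI)
  define a where "a = (\<mu> + \<nu> + 1) / 2"
  define b where "b = (\<mu> - \<nu>) / 2"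
  define c where "c = 1 + \<mu>"
  define d where "d = \<nu> + 1"
  note defs = a_def[symmetric] b_def[symmetric] c_def[symmetric] d_def[symmetric]
  have a2: "- (\<mu> + \<nu> + 1) + 2 * a = 0" "- \<mu> + 2 * a = \<nu> + 1"
    unfolding a_def by (simp_all add: field_simps)
  have cb: "c - (b + d) = b" "c - b = b + d" by (simp_all add: b_def c_def d_def field_simps)
  {
    fix x :: real
    assume x: "(2 powr (- 1 / 2) < x \<and> x < 1)
          \<or> (x = 2 powr (- 1 / 2) \<and> Re (3 * \<nu> - \<mu>) < - 1)
          \<or> (0 < x \<and> x < 1 \<and>
               ((\<exists>k::nat. k \<ge> 1 \<and> - \<nu> = of_nat k) \<or>
                (\<exists>k::nat. - ((\<mu> + \<nu> + 1) / 2) = of_nat k)))"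
    \<comment> \<open>\<open>r\<^sup>2 = 1 / 2\<close>, so \<open>r < x\<close> means \<open>1 - 1 / x\<^sup>2 > - 1\<close>.\<close>
    define r where "r = (2 :: real) powr (- 1 / 2)"
    have r: "r > 0" "r\<^sup>2 = 1 / 2" "r < 1"
      using powr_powr[of "2 :: real" "- 1 / 2" 2] powr_less_mono[of "- 1 / 2" 0 "2 :: real"]
      by (simp_all add: r_def powr_numeral powr_minus_divide)
    have x01: "0 < x" "x < 1" using x[folded r_def] r by auto
    define w where "w = complex_of_real (1 - 1 / x\<^sup>2)"
    have x2: "0 < x\<^sup>2" "x\<^sup>2 < 1" using x01 by (simp_all add: power_less_one_iff)
    have w: "w \<in> hyp_domain" using x2 by (simp add: w_def hyp_domain_def field_simps)
    have "(\<lambda>n. pochhammer a n * pochhammer d n / fact n * w ^ n * hypergeo_reg b (a + of_nat n) (c + of_nat n) w)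
        sums hypergeo_reg a (b + d) c w"
      using x
    proof (elim disjE conjE exE)
      assume "2 powr (- 1 / 2) < x"
      hence "r\<^sup>2 < x\<^sup>2" using r by (intro power_strict_mono) (auto simp: r_def)
      hence "\<bar>1 - 1 / x\<^sup>2\<bar> < 1" using x2 r by (simp add: abs_less_iff field_simps)
      hence "norm w < 1" by (simp only: w_def norm_of_real)
      thus ?thesis by (rule addition_series_disc)
    next
      assume "x = 2 powr (- 1 / 2)" "Re (3 * \<nu> - \<mu>) < - 1"
      hence "x\<^sup>2 = 1 / 2" using r by (simp add: r_def)
      hence "1 - 1 / x\<^sup>2 = - 1" by (simp only:) simp
      hence "w = - 1" by (simp only: w_def of_real_minus of_real_1)
      moreover have "a + d - c = (3 * \<nu> - \<mu> + 1) / 2" by (simp add: a_def c_def d_def field_simps)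
      hence eq: "Re (a + d - c) = (Re (3 * \<nu> - \<mu>) + 1) / 2" by (simp only:) simp
      have "Re (a + d - c) < 0" unfolding eq using \<open>Re (3 * \<nu> - \<mu>) < - 1\<close> by simp
      ultimately show ?thesis using addition_series_minus_1 by simp
    next
      fix k :: nat assume k: "k \<ge> 1" "- \<nu> = of_nat k"
      obtain j where j: "k = Suc j" using k(1) by (cases k) auto
      have "\<nu> = - of_nat k" using k(2) by (metis add.inverse_inverse)
      hence "d = - of_nat j" by (simp add: d_def j)
      hence "pochhammer d n = 0" if "n \<ge> k" for n
        using that by (simp add: j pochhammer_of_nat_eq_0_lemma)
      thus ?thesis using w by (intro addition_series_terminating[of k]) auto
    next
      fix k :: nat assume "- ((\<mu> + \<nu> + 1) / 2) = of_nat k"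
      hence "a = - of_nat k" unfolding a_def by (metis add.inverse_inverse)
      hence "pochhammer a n = 0" if "n \<ge> Suc k" for n
        using that by (simp add: pochhammer_of_nat_eq_0_lemma)
      thus ?thesis using w by (intro addition_series_terminating[of "Suc k"]) auto
    qed
    hence "(\<lambda>n. 2 powr (- \<mu>) * of_real (1 - x\<^sup>2) powr (\<mu> / 2) * of_real x powr (- (\<mu> + \<nu> + 1)) *
        (pochhammer a n * pochhammer d n / fact n * w ^ n * hypergeo_reg b (a + of_nat n) (c + of_nat n) w))
        sums (2 powr (- \<mu>) * of_real (1 - x\<^sup>2) powr (\<mu> / 2) * of_real x powr (- (\<mu> + \<nu> + 1)) * hypergeo_reg a (b + d) c w)"
      by (rule sums_mult)
    also have "2 powr (- \<mu>) * of_real (1 - x\<^sup>2) powr (\<mu> / 2) * of_real x powr (- (\<mu> + \<nu> + 1)) * hypergeo_reg a (b + d) c w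
        = legendre_P \<nu> (- \<mu>) x"
    proof -
      have "legendre_P \<nu> (- \<mu>) x = 2 powr (- \<mu>) * of_real (1 - x\<^sup>2) powr (\<mu> / 2) * hypergeo_reg a b c (of_real (1 - x\<^sup>2))"
        using legendre_P_quadratic[of x \<nu> \<mu>] x01 x2 by (simp add: defs)
      moreover have "hypergeo_reg a (b + d) c w = of_real x powr (2 * a) * hypergeo_reg a b c (of_real (1 - x\<^sup>2))"
        unfolding w_def pfaff_inverse_square[OF x01] cb ..
      moreover have "of_real x powr (- (\<mu> + \<nu> + 1)) * of_real x powr (2 * a) = (1 :: complex)"
        using x01 by (simp only: powr_add[symmetric] a2(1)) simp
      ultimately show ?thesis by (simp add: mult_ac)
    qed
    finally show "(\<lambda>n::nat.
                 pochhammer ((\<mu> + \<nu> + 1) / 2) n * pochhammer (\<nu> + 1) n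
                 / ((- 2) powi (- int n) * fact n
                    * complex_of_real (1 - x\<^sup>2) powr (- of_nat n / 2)
                    * complex_of_real x powr (\<nu> + of_nat n + 1))
                 * legendre_P (\<nu> + of_nat n) (- \<mu> - of_nat n) (1 / x))
              sums legendre_P \<nu> (- \<mu>) x"
      unfolding reciprocal_term_eq[OF x01] a_def b_def c_def d_def w_def .
  next
    fix x :: real
    assume "0 < x \<and> x < 1"
    hence x01: "0 < x" "x < 1" by simp_all
    define y where "y = complex_of_real (1 - x\<^sup>2)"
    have x2: "0 < x\<^sup>2" "x\<^sup>2 < 1" using x01 by (simp_all add: power_less_one_iff)
    hence "norm y < 1" unfolding y_def norm_of_real by simp
    hence "(\<lambda>n. pochhammer a n * pochhammer d n / fact n * y ^ n * hypergeo_reg b (a + of_nat n) (c + of_nat n) y)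
        sums hypergeo_reg a (b + d) c y"
      by (rule addition_series_disc)
    hence "(\<lambda>n. 2 powr (- \<mu>) * of_real (1 - x\<^sup>2) powr (\<mu> / 2) *
        (pochhammer a n * pochhammer d n / fact n * y ^ n * hypergeo_reg b (a + of_nat n) (c + of_nat n) y))
        sums (2 powr (- \<mu>) * of_real (1 - x\<^sup>2) powr (\<mu> / 2) * hypergeo_reg a (b + d) c y)"
      by (rule sums_mult)
    also have "2 powr (- \<mu>) * of_real (1 - x\<^sup>2) powr (\<mu> / 2) * hypergeo_reg a (b + d) c y
        = legendre_P \<nu> (- \<mu>) (1 / x) / complex_of_real x powr (\<nu> + 1)"
    proof -
      have "legendre_P \<nu> (- \<mu>) (1 / x) = 2 powr (- \<mu>) * of_real (1 - x\<^sup>2) powr (\<mu> / 2) * of_real x powr (- \<mu>) *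
          (of_real x powr (2 * a) * hypergeo_reg a (b + d) c y)"
        using legendre_P_reciprocal[OF x01, of \<nu> \<mu>]
        unfolding defs pfaff_inverse_square[OF x01] cb y_def .
      moreover have "of_real x powr (- \<mu>) * of_real x powr (2 * a) = complex_of_real x powr (\<nu> + 1)"
        by (simp only: powr_add[symmetric] a2(2))
      moreover have "complex_of_real x powr (\<nu> + 1) \<noteq> 0" using x01 by simp
      ultimately show ?thesis by (simp add: field_simps)
    qed
    finally show "(\<lambda>n::nat.
                 pochhammer ((\<mu> + \<nu> + 1) / 2) n * pochhammer (\<nu> + 1) n
                 / (2 powi (- int n) * fact n
                    * complex_of_real (1 - x\<^sup>2) powr (- of_nat n / 2))
                 * legendre_P (\<nu> + of_nat n) (- \<mu> - of_nat n) x)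
              sums (legendre_P \<nu> (- \<mu>) (1 / x) / complex_of_real x powr (\<nu> + 1))"
      unfolding direct_term_eq[OF x01] a_def b_def c_def d_def y_def .
  }
qed

end
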